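(* (i) $R_n(1/24/3)$ is the set of all restricted growth functions $w$ of length $n$, with largest letter $m$, satisfying one of the following: (A) $m\le2$; or (B) $m\ge3$ and $w$ is a weakly increasing word with a block of $1$s of any size inserted between two distinct terms; or (C) $m\ge3$ and $w$ is a word beginning with $1$s and $2$s in any order, followed by a weakly increasing suffix that begins with the first occurrence of $3$. (ii) $$\#\Pi_n(1/24/3)=2^{n-1}+\sum_{m=3}^n\binom{n-1}{n-m}+\sum_{m=3}^{n-1}\ \sum_{k=m-1}^{n-2}\binom{k-1}{k-m+1}\Big[(2^{\,n-k-1}-1)+(m-2)(n-k-1)\Big].$$
   Context: A set partition $\sigma$ of $[n]=\{1,\dots,n\}$ is written $\sigma=B_1/B_2/\dots/B_m$ with blocks ordered so that $\min B_1<\dots<\min B_m$. For $A\subseteq[n]$, the subpartition $A\cap\sigma$ is the set partition of $A$ formed by the nonempty sets $A\cap B_i$; it is standardized by replacing its smallest element by $1$, the next smallest by $2$, and so on. $\sigma$ contains a pattern $\pi$ (a set partition of some $[k]$) if some subpartition of $\sigma$ standardizes to $\pi$; otherwise $\sigma$ avoids $\pi$. $\Pi_n(\pi)$ is the set of set partitions of $[n]$ avoiding $\pi$. A restricted growth function (RGF) of length $n$ is a word $w=w_1\cdots w_n$ of positive integers with $w_1=1$ and $w_i\le 1+\max\{w_1,\dots,w_{i-1}\}$ for $i\ge2$. To $\sigma=B_1/\dots/B_m$ corresponds the RGF $w(\sigma)$ with $w_i=j$ if $i\in B_j$. $R_n(\pi)=\{w(\sigma):\sigma\in\Pi_n(\pi)\}$.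 A block of a letter is a run of consecutive copies of it. The pattern $1/24/3$ is the set partition $\{1\},\{2,4\},\{3\}$ of $[4]$.
   Formalization: In (B) the block of 1s may also be inserted after the last letter, not only between two distinct terms; read literally (i) fails, since 1231 (the partition 14/2/3) avoids 1/24/3 but satisfies none of (A), (B), (C). *)

theory Defs
  imports "HOL-Library.Disjoint_Sets"
begin

text \<open>Set partitions of \<open>[n]\<close> are the sets of blocks \<open>\<sigma>\<close> with \<^term>\<open>partition_on {1..n} \<sigma>\<close>;
  the ground set of a partition \<open>\<sigma>\<close> is \<^term>\<open>\<Union>\<sigma>\<close>.\<close>

definition subpartition :: "nat set \<Rightarrow> nat set set \<Rightarrow> nat set set" where
  "subpartition A \<sigma> = {A \<inter> B | B. B \<in> \<sigma> \<and> A \<inter> B \<noteq> {}}"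

text \<open>For finite \<open>A\<close>, the i-th smallest element of \<open>A\<close> has rank \<open>i\<close>, so that replacing each
  element by its rank in the ground set is standardization.\<close>

definition rank_in :: "nat set \<Rightarrow> nat \<Rightarrow> nat" where
  "rank_in A x = card {y \<in> A. y \<le> x}"

definition standardize :: "nat set set \<Rightarrow> nat set set" where
  "standardize \<sigma> = (\<lambda>B. rank_in (\<Union>\<sigma>) ` B) ` \<sigma>"

definition contains_pattern :: "nat set set \<Rightarrow> nat set set \<Rightarrow> bool" where
  "contains_pattern \<sigma> \<pi> \<longleftrightarrow> (\<exists>A \<subseteq> \<Union>\<sigma>. standardize (subpartition A \<sigma>) = \<pi>)"

definition avoiding_partitions :: "nat \<Rightarrow> nat set set \<Rightarrow> nat set set set" where
  "avoiding_partitions n \<pi> = {\<sigma>. partition_on {1..n} \<sigma> \<and> \<not> contains_pattern \<sigma> \<pi>}"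

definition is_RGF :: "nat list \<Rightarrow> bool" where
  "is_RGF w \<longleftrightarrow> w \<noteq> [] \<and> (\<forall>a \<in> set w. 1 \<le> a) \<and> w ! 0 = 1 \<and>
     (\<forall>i. 1 \<le> i \<and> i < length w \<longrightarrow> w ! i \<le> 1 + Max (set (take i w)))"

text \<open>When the blocks \<open>B\<^sub>1, \<dots>, B\<^sub>m\<close> of \<open>\<sigma>\<close> are ordered by increasing minima, the block \<open>B\<^sub>j\<close>
  is the one for which exactly \<open>j\<close> blocks have a minimum at most \<open>Min B\<^sub>j\<close>.\<close>

definition block_index :: "nat set set \<Rightarrow> nat set \<Rightarrow> nat" where
  "block_index \<sigma> B = card {C \<in> \<sigma>. Min C \<le> Min B}"

text \<open>List positions start at 0, so the letter \<open>w\<^sub>i\<close> is \<open>w ! (i - 1)\<close>.\<close>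

definition RGF_of :: "nat \<Rightarrow> nat set set \<Rightarrow> nat list" where
  "RGF_of n \<sigma> = map (\<lambda>i. block_index \<sigma> (THE B. B \<in> \<sigma> \<and> i \<in> B)) [1..<Suc n]"

definition avoiding_RGFs :: "nat \<Rightarrow> nat set set \<Rightarrow> nat list set" where
  "avoiding_RGFs n \<pi> = RGF_of n ` avoiding_partitions n \<pi>"

definition pattern_1_24_3 :: "nat set set" where
  "pattern_1_24_3 = {{1}, {2, 4}, {3}}"

text \<open>A weakly increasing word \<open>u @ v\<close> with a block of \<open>j\<close> ones inserted between \<open>u\<close> and \<open>v\<close>,
  without splitting a run of equal letters. The position after the last letter (\<open>v = []\<close>)
  is admitted: \<open>1231\<close>, for instance, avoids \<open>1/24/3\<close>.\<close>

definition increasing_with_inserted_ones :: "nat list \<Rightarrow> bool" where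
  "increasing_with_inserted_ones w \<longleftrightarrow>
     (\<exists>u v j. w = u @ replicate j 1 @ v \<and> sorted (u @ v) \<and>
        u \<noteq> [] \<and> (v = [] \<or> last u \<noteq> hd v))"

text \<open>As \<open>u\<close> contains no 3, the 3 at the head of \<open>v\<close> is the first one in \<open>w\<close>.\<close>

definition ones_twos_then_increasing :: "nat list \<Rightarrow> bool" where
  "ones_twos_then_increasing w \<longleftrightarrow>
     (\<exists>u v. w = u @ v \<and> set u \<subseteq> {1, 2} \<and> v \<noteq> [] \<and> hd v = 3 \<and> sorted v)"

end

theory Submission
  imports Defs
begin

text \<open>
  The partition contains \<open>1/24/3\<close> iff its restricted growth function has four positions carrying
  letters \<open>x, y, z, y\<close> with \<open>x\<close>, \<open>y\<close>, \<open>z\<close> pairwise distinct. Appending a letter \<open>y\<close> creates such an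
  occurrence iff \<open>y\<close> already occurs between two distinct letters different from it. Tracking these
  blocked letters shows that the avoiding words are exactly those accepted by an automaton with six
  states whose only moves append the current maximum, a new maximum, or a \<open>1\<close>. The normal forms
  describe the paths of the automaton. Its transfer equations, for words of length \<open>n + 1\<close>, give
  \<open>2 ^ n\<close> words with at most two letters, \<open>2 ^ n - n - 1\<close> weakly increasing words with at least three,
  and \<open>(n - 4) * 2 ^ n + 2 * n + 4\<close> further words; the binomial sums have the same closed forms.
\<close>

section \<open>The pattern in words\<close>

definition precedes :: "'a list \<Rightarrow> 'a \<Rightarrow> 'a \<Rightarrow> bool" where
  "precedes w z x \<longleftrightarrow> (\<exists>a b. a < b \<and> b < length w \<and> w ! a = z \<and> w ! b = x)"

text \<open>One more \<open>x\<close> would complete the pattern: \<open>b\<close> holds the first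
  of the two equal letters, \<open>a\<close> and \<open>c\<close> hold the singletons.\<close>

definition blocked :: "'a list \<Rightarrow> 'a \<Rightarrow> bool" where
  "blocked w x \<longleftrightarrow> (\<exists>a b c. a < b \<and> b < c \<and> c < length w \<and>
     w ! b = x \<and> w ! a \<noteq> x \<and> w ! c \<noteq> x \<and> w ! a \<noteq> w ! c)"

text \<open>Set partitions are blind to the order of letters, so every occurrence of \<open>x, y, z, y\<close> with
  pairwise distinct letters counts, not only those with \<open>x < y < z\<close>.\<close>

definition contains_1232 :: "'a list \<Rightarrow> bool" where
  "contains_1232 w \<longleftrightarrow> (\<exists>a b c d. a < b \<and> b < c \<and> c < d \<and> d < length w \<and>
     w ! b = w ! d \<and> w ! a \<noteq> w ! b \<and> w ! c \<noteq> w ! b \<and> w ! a \<noteq> w ! c)"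

section \<open>Appending one letter to a word\<close>

lemma precedes_snoc:
  "precedes (w @ [y]) z x \<longleftrightarrow> precedes w z x \<or> x = y \<and> z \<in> set w"
proof
  assume "precedes (w @ [y]) z x"
  then obtain a b where "a < b" "b < Suc (length w)" "(w @ [y]) ! a = z" "(w @ [y]) ! b = x"
    by (auto simp: precedes_def)
  then show "precedes w z x \<or> x = y \<and> z \<in> set w"
    unfolding precedes_def
    by (cases "b < length w") (auto simp: nth_append less_Suc_eq)
next
  assume "precedes w z x \<or> x = y \<and> z \<in> set w"
  then show "precedes (w @ [y]) z x"
  proof
    assume "precedes w z x"
    then obtain a b where "a < b" "b < length w" "w ! a = z" "w ! b = x"
      by (auto simp: precedes_def)
    then show ?thesis
      unfolding precedes_def by (intro exI[of _ a] exI[of _ b]) (simp add: nth_append)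
  next
    assume "x = y \<and> z \<in> set w"
    then obtain a where "x = y" "a < length w" "w ! a = z"
      by (auto simp: in_set_conv_nth)
    then show ?thesis
      unfolding precedes_def by (intro exI[of _ a] exI[of _ "length w"]) (simp add: nth_append)
  qed
qed

text \<open>The appended letter is last, so it can only act as position \<open>c\<close>. Hence
  \<open>blocked\<close>, \<open>precedes\<close> and the set of letters are all that must be
  remembered when a word is read letter by letter.\<close>

lemma blocked_snoc:
  "blocked (w @ [y]) x \<longleftrightarrow> blocked w x \<or> x \<noteq> y \<and> (\<exists>z. z \<noteq> x \<and> z \<noteq> y \<and> precedes w z x)"
proof
  assume "blocked (w @ [y]) x"
  then obtain a b c where "a < b" "b < c" "c < Suc (length w)" "(w @ [y]) ! b = x"
    "(w @ [y]) ! a \<noteq> x" "(w @ [y]) ! c \<noteq> x" "(w @ [y]) ! a \<noteq> (w @ [y]) ! c"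
    by (auto simp: blocked_def)
  then have *: "a < b" "b < c" "b < length w" "w ! b = x" "w ! a \<noteq> x"
    "c < length w \<and> w ! c \<noteq> x \<and> w ! a \<noteq> w ! c \<or> x \<noteq> y \<and> w ! a \<noteq> y"
    by (auto simp: nth_append less_Suc_eq)
  then have "precedes w (w ! a) x"
    unfolding precedes_def by blast
  with * show "blocked w x \<or> x \<noteq> y \<and> (\<exists>z. z \<noteq> x \<and> z \<noteq> y \<and> precedes w z x)"
    unfolding blocked_def by blast
next
  assume "blocked w x \<or> x \<noteq> y \<and> (\<exists>z. z \<noteq> x \<and> z \<noteq> y \<and> precedes w z x)"
  then show "blocked (w @ [y]) x"
  proof
    assume "blocked w x"
    then obtain a b c where "a < b" "b < c" "c < length w" "w ! b = x"
      "w ! a \<noteq> x" "w ! c \<noteq> x" "w ! a \<noteq> w ! c"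
      by (auto simp: blocked_def)
    then show ?thesis
      unfolding blocked_def
      by (intro exI[of _ a] exI[of _ b] exI[of _ c]) (simp add: nth_append)
  next
    assume "x \<noteq> y \<and> (\<exists>z. z \<noteq> x \<and> z \<noteq> y \<and> precedes w z x)"
    then obtain a b where "x \<noteq> y" "a < b" "b < length w" "w ! b = x" "w ! a \<noteq> x" "w ! a \<noteq> y"
      by (auto simp: precedes_def)
    then show ?thesis
      unfolding blocked_def
      by (intro exI[of _ a] exI[of _ b] exI[of _ "length w"]) (simp add: nth_append)
  qed
qed

text \<open>An occurrence that uses the last position uses it as \<open>d\<close>, and the other
  three positions then witness that this letter is blocked.\<close>

lemma contains_1232_snoc:
  "contains_1232 (w @ [x]) \<longleftrightarrow> contains_1232 w \<or> blocked w x"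
proof
  assume "contains_1232 (w @ [x])"
  then obtain a b c d where "a < b" "b < c" "c < d" "d < Suc (length w)"
    "(w @ [x]) ! b = (w @ [x]) ! d" "(w @ [x]) ! a \<noteq> (w @ [x]) ! b"
    "(w @ [x]) ! c \<noteq> (w @ [x]) ! b" "(w @ [x]) ! a \<noteq> (w @ [x]) ! c"
    by (auto simp: contains_1232_def)
  then have "a < b" "b < c" "c < length w" "w ! a \<noteq> w ! b" "w ! c \<noteq> w ! b" "w ! a \<noteq> w ! c"
    "c < d \<and> d < length w \<and> w ! b = w ! d \<or> w ! b = x"
    by (auto simp: nth_append less_Suc_eq)
  then show "contains_1232 w \<or> blocked w x"
    unfolding contains_1232_def blocked_def by blast
next
  assume "contains_1232 w \<or> blocked w x"
  then show "contains_1232 (w @ [x])"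
  proof
    assume "contains_1232 w"
    then obtain a b c d where "a < b" "b < c" "c < d" "d < length w"
      "w ! b = w ! d" "w ! a \<noteq> w ! b" "w ! c \<noteq> w ! b" "w ! a \<noteq> w ! c"
      by (auto simp: contains_1232_def)
    then show ?thesis
      unfolding contains_1232_def
      by (intro exI[of _ a] exI[of _ b] exI[of _ c] exI[of _ d]) (simp add: nth_append)
  next
    assume "blocked w x"
    then obtain a b c where "a < b" "b < c" "c < length w" "w ! b = x"
      "w ! a \<noteq> x" "w ! c \<noteq> x" "w ! a \<noteq> w ! c"
      by (auto simp: blocked_def)
    then show ?thesis
      unfolding contains_1232_def
      by (intro exI[of _ a] exI[of _ b] exI[of _ c] exI[of _ "length w"]) (simp add: nth_append)
  qed
qed

lemma not_blocked_singleton: "\<not> blocked [y] x"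
  by (auto simp: blocked_def)

lemma not_contains_1232_singleton: "\<not> contains_1232 [y]"
  by (auto simp: contains_1232_def)

lemma is_RGF_singleton [simp]: "is_RGF [x] \<longleftrightarrow> x = 1"
  by (auto simp: is_RGF_def)

lemma is_RGF_snoc:
  assumes "w \<noteq> []"
  shows "is_RGF (w @ [x]) \<longleftrightarrow> is_RGF w \<and> 1 \<le> x \<and> x \<le> Suc (Max (set w))"
proof -
  have "(\<forall>i. 1 \<le> i \<and> i < length (w @ [x]) \<longrightarrow> (w @ [x]) ! i \<le> 1 + Max (set (take i (w @ [x]))))
    \<longleftrightarrow> (\<forall>i. 1 \<le> i \<and> i < length w \<longrightarrow> w ! i \<le> 1 + Max (set (take i w)))
        \<and> x \<le> Suc (Max (set w))" (is "?L \<longleftrightarrow> ?R")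
  proof
    assume L: ?L
    have "w ! i \<le> 1 + Max (set (take i w))" if "1 \<le> i \<and> i < length w" for i
      using L[rule_format, of i] that by (simp add: nth_append)
    moreover have "x \<le> Suc (Max (set w))"
      using L[rule_format, of "length w"] assms by (simp add: Suc_le_eq)
    ultimately show ?R by blast
  next
    assume R: ?R
    show ?L
    proof (intro allI impI)
      fix i assume "1 \<le> i \<and> i < length (w @ [x])"
      then show "(w @ [x]) ! i \<le> 1 + Max (set (take i (w @ [x])))"
        using R by (cases "i = length w") (auto simp: nth_append)
    qed
  qed
  then show ?thesis
    using assms by (auto simp: is_RGF_def nth_append)
qed

section \<open>An automaton for the avoiding words\<close>

text \<open>\<open>Ones_Tail\<close>: at least three letters, weakly increasing up to a nonempty final run of ones.
  \<open>Resumed\<close>: at least three letters, not weakly increasing, ending in the maximum; from then on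
  only the maximum or a new letter can follow.\<close>

datatype shape = Ones | Sorted12 | Unsorted12 | Increasing | Ones_Tail | Resumed

fun after_new :: "shape \<Rightarrow> shape" where
  "after_new Ones = Sorted12"
| "after_new Sorted12 = Increasing"
| "after_new Unsorted12 = Resumed"
| "after_new Increasing = Increasing"
| "after_new Ones_Tail = Resumed"
| "after_new Resumed = Resumed"

fun after_one :: "shape \<Rightarrow> shape" where
  "after_one Sorted12 = Unsorted12"
| "after_one Increasing = Ones_Tail"
| "after_one s = s"

text \<open>The side conditions exclude the moves that would append a blocked letter, and also the
  letter 1 in state \<open>Ones\<close>, where it is the maximum and already covered by
  \<open>stay\<close>. Each word thus arises from its prefix by a single move.\<close>

inductive shaped :: "shape \<Rightarrow> nat list \<Rightarrow> bool" where
  init: "shaped Ones [1]"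
| stay: "shaped s w \<Longrightarrow> s \<noteq> Ones_Tail \<Longrightarrow> shaped s (w @ [Max (set w)])"
| new: "shaped s w \<Longrightarrow> shaped (after_new s) (w @ [Suc (Max (set w))])"
| one: "shaped s w \<Longrightarrow> s \<noteq> Ones \<Longrightarrow> s \<noteq> Resumed \<Longrightarrow> shaped (after_one s) (w @ [1])"

section \<open>Invariants of the states\<close>

lemma precedes_in_set: "precedes w z x \<Longrightarrow> z \<in> set w \<and> x \<in> set w"
  by (auto simp: precedes_def)

text \<open>For a word with letters \<open>1..m\<close>: its blocked letters, and the order facts
  needed to compute what the next move blocks. The clause with \<open>z \<le> x\<close> expresses
  that the word is weakly increasing.\<close>

fun shape_inv :: "shape \<Rightarrow> nat list \<Rightarrow> nat \<Rightarrow> bool" where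
  "shape_inv Ones w m \<longleftrightarrow> m = 1 \<and> (\<forall>x. \<not> blocked w x)"
| "shape_inv Sorted12 w m \<longleftrightarrow> m = 2 \<and> (\<forall>x. \<not> blocked w x) \<and> precedes w 1 2 \<and>
     (\<forall>x z. precedes w z x \<longrightarrow> z \<le> x)"
| "shape_inv Unsorted12 w m \<longleftrightarrow> m = 2 \<and> (\<forall>x. \<not> blocked w x) \<and> precedes w 1 2 \<and> precedes w 2 1"
| "shape_inv Increasing w m \<longleftrightarrow> m \<ge> 3 \<and> (\<forall>x. blocked w x \<longleftrightarrow> 1 < x \<and> x < m) \<and>
     (\<forall>x z. 1 \<le> z \<and> z < x \<and> x \<le> m \<longrightarrow> precedes w z x) \<and> (\<forall>x z. precedes w z x \<longrightarrow> z \<le> x)"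
| "shape_inv Ones_Tail w m \<longleftrightarrow> m \<ge> 3 \<and> (\<forall>x. blocked w x \<longleftrightarrow> 1 < x \<and> x \<le> m) \<and> precedes w 2 1"
| "shape_inv Resumed w m \<longleftrightarrow> m \<ge> 3 \<and> (\<forall>x. blocked w x \<longleftrightarrow> 1 \<le> x \<and> x < m) \<and> precedes w 1 m"

lemma blocked_snocI:
  "blocked w x \<Longrightarrow> blocked (w @ [y]) x"
  "precedes w z x \<Longrightarrow> z \<noteq> x \<Longrightarrow> z \<noteq> y \<Longrightarrow> x \<noteq> y \<Longrightarrow> blocked (w @ [y]) x"
  by (auto simp: blocked_snoc)

lemma blocked_snocE:
  assumes "blocked (w @ [y]) x"
  obtains "blocked w x" | z where "precedes w z x" "z \<noteq> x" "z \<noteq> y" "x \<noteq> y" "z \<in> set w" "x \<in> set w"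
  using assms precedes_in_set by (fastforce simp: blocked_snoc)

text \<open>Repeating the maximum blocks nothing new: two letters are too few for it, and in
  \<open>Increasing\<close> and \<open>Resumed\<close> every letter it could block is blocked
  already.\<close>

lemma shape_inv_stay:
  assumes "m \<ge> 1" "set w = {1..m}" "shape_inv s w m" "s \<noteq> Ones_Tail"
  shows "shape_inv s (w @ [m]) m"
proof -
  have b: "blocked (w @ [m]) x \<longleftrightarrow> blocked w x" if "m \<le> 2 \<or> s = Increasing \<or> s = Resumed" for x
  proof
    assume "blocked (w @ [m]) x"
    then show "blocked w x"
    proof (cases rule: blocked_snocE)
      case (2 z)
      then show ?thesis using assms that by (cases s) fastforce+
    qed
  qed (rule blocked_snocI)
  show ?thesis
    using assms b by (cases s) (auto simp: precedes_snoc)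
qed

text \<open>A fresh letter differs from all earlier ones, so it blocks every \<open>x\<close> with
  some other letter before it: all old letters except 1 if the word is weakly increasing, all old
  letters otherwise. The witnesses are 1 in front of a larger letter and 2 in front of 1.\<close>

lemma shape_inv_new:
  assumes "m \<ge> 1" "set w = {1..m}" "shape_inv s w m"
  shows "shape_inv (after_new s) (w @ [Suc m]) (Suc m)"
proof (cases s)
  case Ones
  then show ?thesis
    using assms by (auto simp: precedes_snoc elim!: blocked_snocE dest: precedes_in_set)
next
  case Sorted12
  have "blocked (w @ [Suc m]) x \<longleftrightarrow> x = 2" for x
  proof
    assume "blocked (w @ [Suc m]) x"
    then show "x = 2" using assms Sorted12 by (elim blocked_snocE) fastforce+
  next
    assume "x = 2"
    then show "blocked (w @ [Suc m]) x"
      using assms Sorted12 by (auto intro: blocked_snocI(2)[of _ 1])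
  qed
  moreover have "precedes w z x" if "1 \<le> z" "z < x" "x \<le> 3" "x \<noteq> 3" for x z
  proof -
    have "z = 1" "x = 2" using that by linarith+
    then show ?thesis using assms Sorted12 by simp
  qed
  ultimately show ?thesis
    using assms Sorted12 by (auto simp: precedes_snoc dest: precedes_in_set)
next
  case Unsorted12
  have "blocked (w @ [Suc m]) x \<longleftrightarrow> x = 1 \<or> x = 2" for x
  proof
    assume "blocked (w @ [Suc m]) x"
    then show "x = 1 \<or> x = 2" using assms Unsorted12 by (elim blocked_snocE) fastforce+
  next
    assume "x = 1 \<or> x = 2"
    then show "blocked (w @ [Suc m]) x"
      using assms Unsorted12
      by (auto intro: blocked_snocI(2)[of _ 1] blocked_snocI(2)[of _ 2])
  qed
  then show ?thesis
    using assms Unsorted12 by (auto simp: precedes_snoc)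
next
  case Increasing
  have "blocked (w @ [Suc m]) x \<longleftrightarrow> 1 < x \<and> x \<le> m" for x
  proof
    assume "blocked (w @ [Suc m]) x"
    then show "1 < x \<and> x \<le> m" using assms Increasing by (elim blocked_snocE) fastforce+
  next
    assume "1 < x \<and> x \<le> m"
    then show "blocked (w @ [Suc m]) x"
      using assms Increasing by (intro blocked_snocI(2)[of _ 1]) auto
  qed
  then show ?thesis
    using assms Increasing by (auto simp: precedes_snoc dest: precedes_in_set)
next
  case Ones_Tail
  have "blocked (w @ [Suc m]) x \<longleftrightarrow> 1 \<le> x \<and> x \<le> m" for x
  proof
    assume "blocked (w @ [Suc m]) x"
    then show "1 \<le> x \<and> x \<le> m" using assms Ones_Tail by (elim blocked_snocE) fastforce+
  next
    assume "1 \<le> x \<and> x \<le> m"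
    then show "blocked (w @ [Suc m]) x"
      using assms Ones_Tail
      by (cases "x = 1") (auto intro: blocked_snocI(1) blocked_snocI(2)[of _ 2])
  qed
  then show ?thesis
    using assms Ones_Tail by (auto simp: precedes_snoc)
next
  case Resumed
  have "blocked (w @ [Suc m]) x \<longleftrightarrow> 1 \<le> x \<and> x \<le> m" for x
  proof
    assume "blocked (w @ [Suc m]) x"
    then show "1 \<le> x \<and> x \<le> m" using assms Resumed by (elim blocked_snocE) fastforce+
  next
    assume "1 \<le> x \<and> x \<le> m"
    then show "blocked (w @ [Suc m]) x"
      using assms Resumed
      by (cases "x = m") (auto intro: blocked_snocI(1) blocked_snocI(2)[of _ 1])
  qed
  then show ?thesis
    using assms Resumed by (auto simp: precedes_snoc)
qed

text \<open>Only in \<open>Increasing\<close> does a further 1 block something, namely the maximum: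
  as \<open>m \<ge> 3\<close>, the letter 2 stands before it and differs from both it and 1.\<close>

lemma shape_inv_one:
  assumes "m \<ge> 1" "set w = {1..m}" "shape_inv s w m" "s \<noteq> Ones" "s \<noteq> Resumed"
  shows "shape_inv (after_one s) (w @ [1]) m"
proof (cases s)
  case Increasing
  have "blocked (w @ [1]) x \<longleftrightarrow> 1 < x \<and> x \<le> m" for x
  proof
    assume "blocked (w @ [1]) x"
    then show "1 < x \<and> x \<le> m" using assms Increasing by (elim blocked_snocE) fastforce+
  next
    assume "1 < x \<and> x \<le> m"
    then show "blocked (w @ [1]) x"
      using assms Increasing
      by (cases "x = m") (auto intro: blocked_snocI(1) blocked_snocI(2)[of _ 2])
  qed
  then show ?thesis
    using assms Increasing by (simp add: precedes_snoc)
next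
  case Ones_Tail
  have "blocked (w @ [1]) x \<longleftrightarrow> 1 < x \<and> x \<le> m" for x
  proof
    assume "blocked (w @ [1]) x"
    then show "1 < x \<and> x \<le> m" using assms Ones_Tail by (elim blocked_snocE) fastforce+
  next
    assume "1 < x \<and> x \<le> m"
    then show "blocked (w @ [1]) x"
      using assms Ones_Tail by (auto intro: blocked_snocI(1))
  qed
  then show ?thesis
    using assms Ones_Tail by (simp add: precedes_snoc)
next
  case Sorted12
  have "\<not> blocked (w @ [1]) x" for x
  proof
    assume "blocked (w @ [1]) x"
    then show False using assms Sorted12 by (elim blocked_snocE) fastforce+
  qed
  then show ?thesis
    using assms Sorted12 by (simp add: precedes_snoc)
next
  case Unsorted12
  have "\<not> blocked (w @ [1]) x" for x
  proof
    assume "blocked (w @ [1]) x"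
    then show False using assms Unsorted12 by (elim blocked_snocE) fastforce+
  qed
  then show ?thesis
    using assms Unsorted12 by (simp add: precedes_snoc)
qed (use assms in auto)

lemma shaped_inv: "shaped s w \<Longrightarrow> \<exists>m\<ge>1. set w = {1..m} \<and> shape_inv s w m"
proof (induction rule: shaped.induct)
  case init
  show ?case
    by (intro exI[of _ 1]) (auto simp: not_blocked_singleton)
next
  case (stay s w)
  then obtain m where m: "m \<ge> 1" "set w = {1..m}" "shape_inv s w m" by blast
  have M: "Max (set w) = m"
    unfolding m(2) using m(1) by (intro Max_eqI) simp_all
  have "set (w @ [m]) = {1..m}" using m(1,2) by (simp add: insert_absorb)
  then show ?case using shape_inv_stay[OF m stay.hyps(2)] m(1) M by metis
next
  case (new s w)
  then obtain m where m: "m \<ge> 1" "set w = {1..m}" "shape_inv s w m" by blast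
  have M: "Max (set w) = m"
    unfolding m(2) using m(1) by (intro Max_eqI) simp_all
  have "set (w @ [Suc m]) = {1..Suc m}" using m(1,2) by (simp add: atLeastAtMostSuc_conv)
  then show ?case using shape_inv_new[OF m] M by (metis le_add1 plus_1_eq_Suc)
next
  case (one s w)
  then obtain m where m: "m \<ge> 1" "set w = {1..m}" "shape_inv s w m" by blast
  have "set (w @ [1]) = {1..m}" using m(1,2) by (simp add: insert_absorb)
  then show ?case using shape_inv_one[OF m one.hyps(2,3)] m(1) by metis
qed

section \<open>The automaton accepts exactly the avoiding words, each in one state\<close>

lemma shaped_Max:
  assumes "shaped s w"
  shows "w \<noteq> []" "set w = {1..Max (set w)}" "Max (set w) \<ge> 1" "shape_inv s w (Max (set w))"
proof -
  obtain m where m: "m \<ge> 1" "set w = {1..m}" "shape_inv s w m"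
    using shaped_inv[OF assms] by blast
  have M: "Max (set w) = m"
    unfolding m(2) using m(1) by (intro Max_eqI) simp_all
  show "w \<noteq> []" using m(1,2) by auto
  show "set w = {1..Max (set w)}" "Max (set w) \<ge> 1" "shape_inv s w (Max (set w))"
    unfolding M by (fact m)+
qed

text \<open>The states are told apart by properties of the word alone, so no word ends in two of
  them and the counts per state may be added.\<close>

lemma shape_inv_determines:
  assumes "shape_inv s w m"
  shows "s = (if m = 1 then Ones
    else if m = 2 then if precedes w 2 1 then Unsorted12 else Sorted12
    else if blocked w 1 then Resumed else if blocked w m then Ones_Tail else Increasing)"
proof (cases s)
  case Sorted12
  \<comment> \<open>For 2 before 1, the weakly increasing clause would give
    \<open>2 \<le> 1\<close>.\<close>
  with assms have "\<not> precedes w 2 1" by force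
  with Sorted12 assms show ?thesis by simp
qed (use assms in simp_all)

lemma shaped_unique: "shaped s w \<Longrightarrow> shaped t w \<Longrightarrow> s = t"
  by (rule trans[OF shape_inv_determines[OF shaped_Max(4)] shape_inv_determines[OF shaped_Max(4), symmetric]])

text \<open>Soundness: by the invariant, each allowed move appends an unblocked letter.\<close>

lemma shaped_avoids:
  assumes "shaped s w"
  shows "is_RGF w \<and> \<not> contains_1232 w"
  using assms
proof (induction rule: shaped.induct)
  case init
  show ?case by (simp add: not_contains_1232_singleton)
next
  case (stay s w)
  have "\<not> blocked w (Max (set w))"
    using shaped_Max(3,4)[OF stay.hyps(1)] stay.hyps(2) by (cases s) auto
  with stay shaped_Max(1,3)[OF stay.hyps(1)] show ?case
    by (auto simp: is_RGF_snoc contains_1232_snoc intro: le_SucI)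
next
  case (new s w)
  have "\<not> blocked w (Suc (Max (set w)))"
    using shaped_Max(3,4)[OF new.hyps] by (cases s) auto
  with new shaped_Max(1,3)[OF new.hyps] show ?case
    by (simp add: is_RGF_snoc contains_1232_snoc)
next
  case (one s w)
  have "\<not> blocked w 1"
    using shaped_Max(3,4)[OF one.hyps(1)] one.hyps(2,3) by (cases s) auto
  with one shaped_Max(1,3)[OF one.hyps(1)] show ?case
    by (simp add: is_RGF_snoc contains_1232_snoc)
qed

text \<open>Completeness of the moves: letters strictly between 1 and \<open>m\<close> exist only
  for \<open>m \<ge> 3\<close>, and then they are all blocked, so 1, \<open>m\<close> and
  \<open>Suc m\<close> are the only candidates.\<close>

lemma not_blocked_cases:
  assumes "shape_inv s w m" "\<not> blocked w x" "1 \<le> x" "x \<le> Suc m"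
  obtains "x = m" "s \<noteq> Ones_Tail" | "x = Suc m" | "x = 1" "s \<noteq> Ones" "s \<noteq> Resumed"
  using assms by (cases s; cases "x = m"; cases "x = Suc m"; cases "x = 1") auto

lemma shaped_exists:
  "is_RGF w \<Longrightarrow> \<not> contains_1232 w \<Longrightarrow> \<exists>s. shaped s w"
proof (induction w rule: rev_induct)
  case Nil
  then show ?case by (simp add: is_RGF_def)
next
  case (snoc x w)
  show ?case
  proof (cases "w = []")
    case True
    then have "w @ [x] = [1]" using snoc.prems by simp
    then show ?thesis using init by metis
  next
    case False
    with snoc.prems have *: "is_RGF w" "1 \<le> x" "x \<le> Suc (Max (set w))"
      "\<not> contains_1232 w" "\<not> blocked w x"
      by (auto simp: is_RGF_snoc contains_1232_snoc)
    then obtain s where s: "shaped s w" using snoc.IH by blast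
    from shaped_Max(4)[OF s] *(5,2,3) show ?thesis
    proof (cases rule: not_blocked_cases)
      case 1
      then show ?thesis using stay[OF s] by metis
    next
      case 2
      then show ?thesis using new[OF s] by metis
    next
      case 3
      then show ?thesis using one[OF s] by metis
    qed
  qed
qed

lemma avoids_iff_shaped: "is_RGF w \<and> \<not> contains_1232 w \<longleftrightarrow> (\<exists>s. shaped s w)"
  using shaped_avoids shaped_exists by blast

section \<open>Counting\<close>

definition words :: "shape \<Rightarrow> nat \<Rightarrow> nat list set" where
  "words s n = {w. length w = n \<and> shaped s w}"

lemma finite_shapes: "finite (A :: shape set)"
proof (rule finite_subset)
  show "A \<subseteq> {Ones, Sorted12, Unsorted12, Increasing, Ones_Tail, Resumed}"
    using shape.exhaust by blast
qed simp

lemma words_1: "words s (Suc 0) = (if s = Ones then {[1]} else {})"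
proof -
  have "w = [1] \<and> s = Ones" if "shaped s w" "length w = Suc 0" for w
    using that
  proof cases
    case (stay v) with shaped_Max(1)[OF stay(2)] that show ?thesis by simp
  next
    case (new t v) with shaped_Max(1)[OF new(3)] that show ?thesis by simp
  next
    case (one t v) with shaped_Max(1)[OF one(3)] that show ?thesis by simp
  qed simp
  then have "words s (Suc 0) \<subseteq> (if s = Ones then {[1]} else {})"
    unfolding words_def by (intro subsetI) (simp, blast)
  moreover have "(if s = Ones then {[1]} else {}) \<subseteq> words s (Suc 0)"
    using init by (simp add: words_def)
  ultimately show ?thesis by blast
qed

lemma words_Suc:
  assumes "n \<ge> 1"
  shows "words s (Suc n) =
    (\<Union>t \<in> {t. t = s \<and> t \<noteq> Ones_Tail}. (\<lambda>w. w @ [Max (set w)]) ` words t n)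
    \<union> (\<Union>t \<in> {t. after_new t = s}. (\<lambda>w. w @ [Suc (Max (set w))]) ` words t n)
    \<union> (\<Union>t \<in> {t. after_one t = s \<and> t \<noteq> Ones \<and> t \<noteq> Resumed}. (\<lambda>w. w @ [1]) ` words t n)"
    (is "_ = ?A \<union> ?B \<union> ?C")
proof (intro set_eqI iffI)
  fix w assume "w \<in> words s (Suc n)"
  then have w: "shaped s w" "length w = Suc n" by (auto simp: words_def)
  from w(1) show "w \<in> ?A \<union> ?B \<union> ?C"
  proof cases
    case init
    with w assms show ?thesis by simp
  next
    case (stay v)
    with w have "v \<in> words s n" by (simp add: words_def)
    with stay show ?thesis by blast
  next
    case (new t v)
    with w have "v \<in> words t n" by (simp add: words_def)
    with new show ?thesis by blast
  next
    case (one t v)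
    with w have "v \<in> words t n" by (simp add: words_def)
    with one show ?thesis by blast
  qed
next
  fix w assume "w \<in> ?A \<union> ?B \<union> ?C"
  then show "w \<in> words s (Suc n)"
    by (elim UnE UN_E imageE) (auto simp: words_def intro: shaped.intros shaped.one[simplified])
qed

lemma words_disjoint: "s \<noteq> t \<Longrightarrow> words s n \<inter> words t n = {}"
  using shaped_unique by (auto simp: words_def)

lemma finite_words: "finite (words s n)"
proof (induction n arbitrary: s)
  case 0
  have "words s 0 = {}" using shaped_Max(1) by (auto simp: words_def)
  then show ?case by simp
next
  case (Suc n)
  then show ?case
    by (cases "n = 0") (simp_all add: words_1 words_Suc finite_shapes)
qed

text \<open>Deleting the last letter recovers \<open>w\<close>, so appending is injective although
  the letter depends on \<open>w\<close>; distinct states contribute disjoint sets.\<close>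

lemma card_UN_append:
  "card (\<Union>t \<in> T. (\<lambda>w. w @ [f w]) ` words t n) = (\<Sum>t \<in> T. card (words t n))"
proof -
  have inj: "inj_on (\<lambda>w. w @ [f w]) A" for A by (auto intro: inj_onI)
  have "card (\<Union>t \<in> T. (\<lambda>w. w @ [f w]) ` words t n) = (\<Sum>t \<in> T. card ((\<lambda>w. w @ [f w]) ` words t n))"
  proof (intro card_UN_disjoint ballI impI)
    fix s t :: shape assume "s \<noteq> t"
    show "(\<lambda>w. w @ [f w]) ` words s n \<inter> (\<lambda>w. w @ [f w]) ` words t n = {}"
      using words_disjoint[OF \<open>s \<noteq> t\<close>, of n] by auto
  qed (simp_all add: finite_shapes finite_words)
  also have "\<dots> = (\<Sum>t \<in> T. card (words t n))"
    by (simp add: card_image inj)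
  finally show ?thesis .
qed

lemma card_words_Suc:
  assumes "n \<ge> 1"
  shows "card (words s (Suc n)) =
    (\<Sum>t | t = s \<and> t \<noteq> Ones_Tail. card (words t n)) + (\<Sum>t | after_new t = s. card (words t n))
    + (\<Sum>t | after_one t = s \<and> t \<noteq> Ones \<and> t \<noteq> Resumed. card (words t n))"
proof -
  let ?stay = "\<Union>t \<in> {t. t = s \<and> t \<noteq> Ones_Tail}. (\<lambda>w. w @ [Max (set w)]) ` words t n"
  let ?new = "\<Union>t \<in> {t. after_new t = s}. (\<lambda>w. w @ [Suc (Max (set w))]) ` words t n"
  let ?one = "\<Union>t \<in> {t. after_one t = s \<and> t \<noteq> Ones \<and> t \<noteq> Resumed}. (\<lambda>w. w @ [1]) ` words t n"
  \<comment> \<open>Separates the \<open>one\<close> moves from the others: outside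
    \<open>Ones\<close> the maximum exceeds 1, so a final 1 is neither the old maximum nor a new
    one.\<close>
  have gt: "Max (set w) > 1" if "w \<in> words t n" "t \<noteq> Ones" for w t
  proof -
    have "shape_inv t w (Max (set w))"
      using that(1) by (intro shaped_Max) (simp add: words_def)
    with that(2) show ?thesis by (cases t) simp_all
  qed
  have "?stay \<inter> ?new = {}" by auto
  moreover have "(?stay \<union> ?new) \<inter> ?one = {}"
  proof (rule equals0I)
    fix v assume v: "v \<in> (?stay \<union> ?new) \<inter> ?one"
    then obtain w t where w: "v = w @ [1]" "w \<in> words t n" "t \<noteq> Ones" by blast
    with v have "1 = Max (set w) \<or> 1 = Suc (Max (set w))" by auto
    with gt[OF w(2,3)] show False by simp
  qed
  moreover have "finite ?stay" "finite ?new" "finite ?one"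
    by (simp_all add: finite_words finite_shapes)
  ultimately show ?thesis
    unfolding words_Suc[OF assms] by (simp only: card_Un_disjoint finite_UnI card_UN_append)
qed

text \<open>Makes sets of source states explicit, so that the simplifier can evaluate the sums over
  predecessors.\<close>

lemma Collect_shape:
  "{t. P t} = (if P Ones then {Ones} else {}) \<union> (if P Sorted12 then {Sorted12} else {})
     \<union> (if P Unsorted12 then {Unsorted12} else {}) \<union> (if P Increasing then {Increasing} else {})
     \<union> (if P Ones_Tail then {Ones_Tail} else {}) \<union> (if P Resumed then {Resumed} else {})"
proof -
  have "t \<in> {t. P t} \<longleftrightarrow> t \<in> (if P Ones then {Ones} else {}) \<union> (if P Sorted12 then {Sorted12} else {})
     \<union> (if P Unsorted12 then {Unsorted12} else {}) \<union> (if P Increasing then {Increasing} else {})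
     \<union> (if P Ones_Tail then {Ones_Tail} else {}) \<union> (if P Resumed then {Resumed} else {})" for t
    by (cases t) auto
  then show ?thesis by blast
qed

text \<open>A factor 2 marks a state with two loops: \<open>stay\<close> and \<open>one\<close> at
  \<open>Unsorted12\<close>, \<open>stay\<close> and \<open>new\<close> at \<open>Increasing\<close>
  and \<open>Resumed\<close>.\<close>

lemma card_words_rec:
  assumes "n \<ge> 1"
  shows "card (words Ones (Suc n)) = card (words Ones n)"
    "card (words Sorted12 (Suc n)) = card (words Sorted12 n) + card (words Ones n)"
    "card (words Unsorted12 (Suc n)) = 2 * card (words Unsorted12 n) + card (words Sorted12 n)"
    "card (words Increasing (Suc n)) = 2 * card (words Increasing n) + card (words Sorted12 n)"
    "card (words Ones_Tail (Suc n)) = card (words Ones_Tail n) + card (words Increasing n)"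
    "card (words Resumed (Suc n)) =
       2 * card (words Resumed n) + card (words Ones_Tail n) + card (words Unsorted12 n)"
  by (simp_all add: card_words_Suc[OF assms] Collect_shape)

text \<open>\<open>Ones_Tail\<close> and \<open>Resumed\<close> are counted together because their
  sum obeys one recurrence: it doubles and gains the words of \<open>Increasing\<close> and
  \<open>Unsorted12\<close>. The additive forms avoid truncated subtraction; the last equation is
  over \<open>int\<close> since \<open>n - 4\<close> may be negative.\<close>

lemma card_words:
  "card (words Ones (Suc n)) = 1"
  "card (words Sorted12 (Suc n)) = n"
  "card (words Unsorted12 (Suc n)) + Suc n = 2 ^ n"
  "card (words Increasing (Suc n)) + Suc n = 2 ^ n"
  "int (card (words Ones_Tail (Suc n)) + card (words Resumed (Suc n)))
     = (int n - 4) * 2 ^ n + 2 * int n + 4"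
proof (induction n)
  case 0
  { case 1 show ?case by (simp add: words_1) }
  { case 2 show ?case by (simp add: words_1) }
  { case 3 show ?case by (simp add: words_1) }
  { case 4 show ?case by (simp add: words_1) }
  { case 5 show ?case by (simp add: words_1) }
next
  case (Suc n)
  { case 1 show ?case using Suc by (simp add: card_words_rec(1)) }
  { case 2 show ?case using Suc by (simp add: card_words_rec(2)) }
  { case 3 show ?case using Suc by (simp add: card_words_rec(3)) }
  { case 4 show ?case using Suc by (simp add: card_words_rec(4)) }
  { case 5
    have "int (card (words Unsorted12 (Suc n))) = 2 ^ n - int n - 1"
      "int (card (words Increasing (Suc n))) = 2 ^ n - int n - 1"
      using arg_cong[OF Suc(3), of int] arg_cong[OF Suc(4), of int] by simp_all
    then show ?case using Suc(5) by (simp add: card_words_rec(5,6) algebra_simps) }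
qed

section \<open>Closed forms of the binomial sums\<close>

lemma sum_binomial_truncated: "(\<Sum>m = 3..Suc n. n choose (Suc n - m)) + Suc n = 2 ^ n"
proof -
  consider "n = 0" | "n = 1" | k where "n = Suc (Suc k)"
    by (metis One_nat_def not0_implies_Suc)
  then show ?thesis
  proof cases
    case 3
    \<comment> \<open>Reversing the index gives row \<open>n\<close> of Pascal's triangle without
      its last two entries, \<open>n\<close> and 1, which add up to \<open>Suc n\<close>.\<close>
    have "(\<Sum>m = 3..Suc n. n choose (Suc n - m)) = (\<Sum>i\<le>k. n choose i)"
      unfolding 3 by (rule sum.reindex_bij_witness[where j = "\<lambda>m. 3 + k - m" and i = "\<lambda>i. 3 + k - i"]) (auto simp: numeral_3_eq_3)
    then show ?thesis
      using choose_row_sum[of n] unfolding 3 by simp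
  qed simp_all
qed

text \<open>This sum and the one in \<open>sum_weighted_powers\<close> are the two halves into which
  the double sum splits; they have the same value.\<close>

lemma sum_powers_minus_one:
  "(\<Sum>p\<le>L. (2 ^ p - 1) * (2 ^ (L - p) - 1)) = (int L - 3) * 2 ^ L + int L + 3"
proof (induction L)
  case (Suc L)
  have gp: "(\<Sum>p\<le>L. 2 ^ p - 1) = (2 ^ Suc L - int L - 2 :: int)" for L
    by (induction L) auto
  \<comment> \<open>By \<open>2 ^ (Suc L - p) - 1 = 2 * (2 ^ (L - p) - 1) + 1\<close>; the term at
    \<open>p = Suc L\<close> is zero.\<close>
  have "(\<Sum>p\<le>Suc L. (2 ^ p - 1) * (2 ^ (Suc L - p) - 1))
      = (\<Sum>p\<le>L. 2 * ((2 ^ p - 1) * (2 ^ (L - p) - 1)) + (2 ^ p - 1 :: int))"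
    by (auto simp: Suc_diff_le algebra_simps intro!: sum.cong)
  also have "\<dots> = 2 * ((int L - 3) * 2 ^ L + int L + 3) + (2 ^ Suc L - int L - 2)"
    by (simp only: sum.distrib gp Suc.IH flip: sum_distrib_left)
  finally show ?case by (simp add: algebra_simps)
qed simp

lemma sum_weighted_powers:
  "(\<Sum>p\<le>L. int p * 2 ^ (p - 1) * int (L - p)) = (int L - 3) * 2 ^ L + int L + 3"
proof (induction L)
  case (Suc L)
  have ap: "(\<Sum>p\<le>L. int p * 2 ^ (p - 1)) = (int L - 1) * 2 ^ L + 1" for L
    by (induction L) (auto simp: algebra_simps)
  have "(\<Sum>p\<le>Suc L. int p * 2 ^ (p - 1) * int (Suc L - p))
      = (\<Sum>p\<le>L. int p * 2 ^ (p - 1) * int (L - p) + int p * 2 ^ (p - 1))"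
    by (auto simp: Suc_diff_le algebra_simps intro!: sum.cong)
  also have "\<dots> = ((int L - 3) * 2 ^ L + int L + 3) + ((int L - 1) * 2 ^ L + 1)"
    by (simp only: sum.distrib ap Suc.IH)
  finally show ?case by (simp add: algebra_simps)
qed simp

text \<open>Evaluates the inner sum of the double sum through the plain and the
  \<open>j\<close>-weighted row sums of Pascal's triangle; the entry at \<open>j = 0\<close> is
  dropped from the first and contributes nothing to the second.\<close>

lemma sum_binomial_linear:
  "(\<Sum>j = 1..p. (p choose j) * (a + j * b)) = (2 ^ p - 1) * a + p * 2 ^ (p - 1) * b" for a b :: nat
proof -
  have "{..p} = insert 0 {1..p}" by auto
  then have *: "(\<Sum>j\<le>p. f j) = f 0 + (\<Sum>j = 1..p. f j)" for f :: "nat \<Rightarrow> nat"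
    by simp
  have "(\<Sum>j = 1..p. p choose j) = 2 ^ p - 1"
    using choose_row_sum[of p] unfolding * by simp
  moreover have "(\<Sum>j = 1..p. j * (p choose j)) = p * 2 ^ (p - 1)"
    using choose_linear_sum[of p] unfolding * by simp
  moreover have "(\<Sum>j = 1..p. (p choose j) * (a + j * b))
      = (\<Sum>j = 1..p. p choose j) * a + (\<Sum>j = 1..p. j * (p choose j)) * b"
    unfolding sum_distrib_right sum.distrib[symmetric] by (simp add: algebra_simps)
  ultimately show ?thesis by simp
qed

text \<open>Here \<open>n\<close> is one less than the length of the words, so that the value
  matches the last equation of \<open>card_words\<close>.\<close>

lemma double_sum_closed_form:
  "int (\<Sum>m = 3..n. \<Sum>k = m - 1..n - 1.
      ((k - 1) choose (k + 1 - m)) * ((2 ^ (n - k) - 1) + (m - 2) * (n - k)))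
    = (int n - 4) * 2 ^ n + 2 * int n + 4"
proof (cases n)
  case (Suc L)
  let ?f = "\<lambda>m k. ((k - 1) choose (k + 1 - m)) * ((2 ^ (n - k) - 1) + (m - 2) * (n - k))"
  let ?g = "\<lambda>p j. (p choose j) * ((2 ^ (L - p) - 1) + j * (L - p))"
  have "(\<Sum>m = 3..n. \<Sum>k = m - 1..n - 1. ?f m k) =
      (\<Sum>(m, k) \<in> (SIGMA m:{3..n}. {m - 1..n - 1}). ?f m k)"
    by (rule sum.Sigma) auto
  \<comment> \<open>Substituting \<open>p = k - 1\<close> and \<open>j = m - 2\<close> turns the
    range into the triangle \<open>1 \<le> j \<le> p \<le> L - 1\<close> and lets \<open>j\<close>
    be summed first.\<close>
  also have "\<dots> = (\<Sum>(p, j) \<in> (SIGMA p:{1..L - 1}. {1..p}). ?g p j)"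
  proof (rule sum.reindex_bij_witness[where j = "\<lambda>(m, k). (k - 1, m - 2)"
        and i = "\<lambda>(p, j). (j + 2, p + 1)"])
    fix x assume "x \<in> (SIGMA m:{3..n}. {m - 1..n - 1})"
    then obtain m k where x: "x = (m, k)" "3 \<le> m" "m - 1 \<le> k" "k \<le> n - 1" by auto
    \<comment> \<open>The lower indices \<open>m - 2\<close> and \<open>k + 1 - m\<close> add up to
      \<open>k - 1\<close>.\<close>
    have "(k - 1) choose (m - 2) = (k - 1) choose (k + 1 - m)"
      using binomial_symmetric[of "m - 2" "k - 1"] x by simp
    moreover have "L - (k - 1) = n - k"
      using x Suc by simp
    ultimately show "(case case x of (m, k) \<Rightarrow> (k - 1, m - 2) of (p, j) \<Rightarrow> ?g p j)
        = (case x of (m, k) \<Rightarrow> ?f m k)"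
      using x(1) by simp
  qed (auto simp: Suc)
  also have "\<dots> = (\<Sum>p = 1..L - 1. \<Sum>j = 1..p. ?g p j)"
    by (rule sum.Sigma[symmetric]) auto
  also have "\<dots> = (\<Sum>p = 1..L - 1. (2 ^ p - 1) * (2 ^ (L - p) - 1) + p * 2 ^ (p - 1) * (L - p))"
    by (simp only: sum_binomial_linear)
  \<comment> \<open>The added terms at \<open>p = 0\<close> and \<open>p = L\<close> are
    zero.\<close>
  also have "\<dots> = (\<Sum>p\<le>L. (2 ^ p - 1) * (2 ^ (L - p) - 1) + p * 2 ^ (p - 1) * (L - p))"
    by (rule sum.mono_neutral_left) (auto simp: not_less_eq_eq Suc_le_eq)
  finally have "int (\<Sum>m = 3..n. \<Sum>k = m - 1..n - 1. ?f m k) =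
      (\<Sum>p\<le>L. (2 ^ p - 1) * (2 ^ (L - p) - 1)) + (\<Sum>p\<le>L. int p * 2 ^ (p - 1) * int (L - p))"
    by (simp add: of_nat_diff sum.distrib)
  then show ?thesis
    unfolding sum_powers_minus_one sum_weighted_powers by (simp add: Suc algebra_simps)
qed simp

section \<open>Normal forms\<close>

lemma is_RGF_prefix: "is_RGF (u @ v) \<Longrightarrow> u \<noteq> [] \<Longrightarrow> is_RGF u"
proof (induction v rule: rev_induct)
  case (snoc x v)
  then show ?case using is_RGF_snoc[of "u @ v" x] by simp
qed simp

lemma sorted_snoc_Max: "sorted w \<Longrightarrow> \<forall>a \<in> set w. a \<le> x \<Longrightarrow> sorted (w @ [x])"
  by (simp add: sorted_append)

text \<open>The case \<open>v \<noteq> []\<close> of \<open>increasing_with_inserted_ones\<close>.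
  It survives appending a letter at least as large as all others; with \<open>v = []\<close> that
  letter could equal \<open>last u\<close>.\<close>

definition split_by_ones :: "nat list \<Rightarrow> bool" where
  "split_by_ones w \<longleftrightarrow> (\<exists>u v j. w = u @ replicate j 1 @ v \<and> sorted (u @ v) \<and>
     u \<noteq> [] \<and> v \<noteq> [] \<and> last u \<noteq> hd v)"

lemma split_by_ones_snoc:
  assumes "split_by_ones w" "\<forall>a \<in> set w. a \<le> x"
  shows "split_by_ones (w @ [x])"
proof -
  obtain u v j where "w = u @ replicate j 1 @ v" "sorted (u @ v)" "u \<noteq> []" "v \<noteq> []" "last u \<noteq> hd v"
    using assms(1) unfolding split_by_ones_def by blast
  then show ?thesis
    unfolding split_by_ones_def using assms(2)
    by (intro exI[of _ u] exI[of _ "v @ [x]"] exI[of _ j]) (auto simp: sorted_append)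
qed

lemma ones_twos_then_increasing_snoc:
  assumes "ones_twos_then_increasing w" "\<forall>a \<in> set w. a \<le> x"
  shows "ones_twos_then_increasing (w @ [x])"
proof -
  obtain u v where "w = u @ v" "set u \<subseteq> {1, 2}" "v \<noteq> []" "hd v = 3" "sorted v"
    using assms(1) by (auto simp: ones_twos_then_increasing_def)
  then show ?thesis
    unfolding ones_twos_then_increasing_def using assms(2)
    by (intro exI[of _ u] exI[of _ "v @ [x]"]) (auto simp: sorted_append)
qed

text \<open>\<open>Resumed\<close> is entered in two ways, which give its two forms: from
  \<open>Unsorted12\<close> the first 3 starts the increasing suffix, and from
  \<open>Ones_Tail\<close> a new maximum closes the block of ones. Later letters never fall below
  the maximum, which preserves both forms.\<close>

lemma shaped_form:
  assumes "shaped s w"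
  shows "(s \<in> {Ones, Sorted12, Increasing} \<longrightarrow> sorted w) \<and>
    (s = Ones_Tail \<longrightarrow> (\<exists>u j. w = u @ replicate j 1 \<and> sorted u \<and> u \<noteq> [])) \<and>
    (s = Resumed \<longrightarrow> ones_twos_then_increasing w \<or> split_by_ones w)"
  using assms
proof (induction rule: shaped.induct)
  case init
  show ?case by simp
next
  case (stay s w)
  let ?x = "Max (set w)"
  have le: "\<forall>a \<in> set w. a \<le> ?x" by simp
  show ?case
  proof (cases "s = Resumed")
    case True
    then show ?thesis
      using stay.IH ones_twos_then_increasing_snoc[OF _ le] split_by_ones_snoc[OF _ le]
      by blast
  next
    case False
    then show ?thesis using stay.IH stay.hyps(2) sorted_snoc_Max[OF _ le] by simp
  qed
next
  case (new s w)
  let ?x = "Suc (Max (set w))"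
  have le: "\<forall>a \<in> set w. a \<le> ?x" by (simp add: le_SucI)
  show ?case
  proof (cases s)
    case Unsorted12
    then have "Max (set w) = 2" using shaped_Max(4)[OF new.hyps] by simp
    moreover have "set w \<subseteq> {1, 2}"
      using shaped_Max(2)[OF new.hyps] unfolding \<open>Max (set w) = 2\<close> by auto
    ultimately have "ones_twos_then_increasing (w @ [?x])"
      unfolding ones_twos_then_increasing_def by (intro exI[of _ w] exI[of _ "[3]"]) auto
    then show ?thesis using Unsorted12 by simp
  next
    case Ones_Tail
    then obtain u j where u: "w = u @ replicate j 1" "sorted u" "u \<noteq> []"
      using new.IH by auto
    \<comment> \<open>The new maximum exceeds \<open>last u\<close>, so the block of ones does not
      split a run.\<close>
    have "last u \<in> set w" using u(1,3) by simp
    then have "last u \<le> Max (set w)" by simp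
    then have "last u \<noteq> ?x" by linarith
    moreover have "\<forall>a \<in> set u. a \<le> ?x" using le u(1) by auto
    ultimately have "w @ [?x] = u @ replicate j 1 @ [?x] \<and> sorted (u @ [?x]) \<and> u \<noteq> [] \<and> last u \<noteq> hd [?x]"
      using u by (simp add: sorted_append)
    then have "split_by_ones (w @ [?x])" unfolding split_by_ones_def by blast
    then show ?thesis using Ones_Tail by simp
  next
    case Resumed
    then show ?thesis
      using new.IH ones_twos_then_increasing_snoc[OF _ le] split_by_ones_snoc[OF _ le]
      by auto
  qed (use new.IH sorted_snoc_Max[OF _ le] in simp_all)
next
  case (one s w)
  show ?case
  proof (cases s)
    case Increasing
    then have "w @ [1] = w @ replicate 1 1 \<and> sorted w \<and> w \<noteq> []"
      using one.IH shaped_Max(1)[OF one.hyps(1)] by simp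
    then have "\<exists>u j. w @ [1] = u @ replicate j 1 \<and> sorted u \<and> u \<noteq> []" by metis
    then show ?thesis using Increasing by simp
  next
    case Ones_Tail
    then obtain u j where u: "w = u @ replicate j 1" "sorted u" "u \<noteq> []"
      using one.IH by auto
    then have "w @ [1] = u @ replicate (Suc j) 1 \<and> sorted u \<and> u \<noteq> []"
      by (simp add: replicate_append_same)
    then have "\<exists>u j. w @ [1] = u @ replicate j 1 \<and> sorted u \<and> u \<noteq> []" by blast
    then show ?thesis using Ones_Tail by simp
  qed (use one.hyps in simp_all)
qed

section \<open>From the normal forms back to the automaton\<close>

lemma after_new_not_Ones_Tail:
  "after_new s \<in> - {Ones_Tail}" "after_new ` A \<subseteq> - {Ones_Tail}"
proof -
  show *: "after_new s \<in> - {Ones_Tail}" for s by (cases s) simp_all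
  show "after_new ` A \<subseteq> - {Ones_Tail}" by (intro image_subsetI *)
qed

text \<open>Each letter of such a suffix is at least the current maximum and at most one more, so
  only \<open>stay\<close> and \<open>new\<close> moves occur. Closure of \<open>T\<close> under
  \<open>after_new\<close>, with \<open>Ones_Tail\<close> outside, keeps \<open>stay\<close>
  available throughout.\<close>

lemma shaped_append_sorted:
  assumes "shaped s w" "s \<in> T" "after_new ` T \<subseteq> T" "Ones_Tail \<notin> T"
    and "is_RGF (w @ v)" "sorted v" "\<forall>a \<in> set v. Max (set w) \<le> a"
  shows "\<exists>t \<in> T. shaped t (w @ v)"
  using assms(5-7)
proof (induction v rule: rev_induct)
  case Nil
  then show ?case using assms(1,2) by auto
next
  case (snoc x v)
  have w: "w \<noteq> []" using shaped_Max(1)[OF assms(1)] .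
  have RGF: "is_RGF (w @ v)" "x \<le> Suc (Max (set (w @ v)))"
    using snoc.prems(1) is_RGF_snoc[of "w @ v" x] w by simp_all
  then obtain t where t: "t \<in> T" "shaped t (w @ v)"
    using snoc.IH snoc.prems(2,3) by (auto simp: sorted_append)
  have "Max (set w) \<le> x" using snoc.prems(3) by simp
  then have "\<forall>a \<in> set (w @ v). a \<le> x"
    using snoc.prems(2) w by (auto simp: sorted_append)
  then have "Max (set (w @ v)) \<le> x" using w by (intro Max.boundedI) auto
  with RGF(2) consider "x = Max (set (w @ v))" | "x = Suc (Max (set (w @ v)))" by linarith
  then show ?case
  proof cases
    case 1
    have "t \<noteq> Ones_Tail" using t(1) assms(4) by blast
    from stay[OF t(2) this] show ?thesis
      using t(1) unfolding 1 by auto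
  next
    case 2
    from new[OF t(2)] show ?thesis
      using t(1) assms(3) unfolding 2 by auto
  qed
qed

text \<open>A 1 is blocked only in \<open>Resumed\<close>, and appending 1 never leads
  there.\<close>

lemma shaped_append_ones:
  assumes "shaped s w" "s \<noteq> Resumed"
  shows "\<exists>t. t \<noteq> Resumed \<and> shaped t (w @ replicate j 1)"
proof (induction j)
  case 0
  then show ?case using assms by auto
next
  case (Suc j)
  then obtain t where t: "t \<noteq> Resumed" "shaped t (w @ replicate j 1)" by blast
  have e: "w @ replicate (Suc j) 1 = (w @ replicate j 1) @ [1::nat]"
    by (simp add: replicate_append_same)
  show ?case
  proof (cases "t = Ones")
    case True
    \<comment> \<open>In \<open>Ones\<close> the letter 1 is the maximum, so the move is
      \<open>stay\<close>.\<close>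
    with shaped_Max(4)[OF t(2)] have "Max (set (w @ replicate j 1)) = 1" by simp
    with stay[OF t(2)] True show ?thesis unfolding e by (metis shape.distinct(7,9))
  next
    case False
    moreover have "after_one t \<noteq> Resumed" using t(1) by (cases t) auto
    ultimately show ?thesis unfolding e using one[OF t(2)] t(1) by blast
  qed
qed

text \<open>Starting from \<open>[1]\<close>, the moves \<open>stay\<close> and \<open>new\<close>
  never leave these three states.\<close>

lemma shaped_sorted:
  assumes "is_RGF w" "sorted w"
  shows "\<exists>s \<in> {Ones, Sorted12, Increasing}. shaped s w"
proof -
  obtain v where w: "w = [1] @ v"
    using assms(1) by (cases w) (auto simp: is_RGF_def)
  have "\<exists>s \<in> {Ones, Sorted12, Increasing}. shaped s ([1] @ v)"
    by (rule shaped_append_sorted[OF init]) (use assms w in auto)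
  then show ?thesis unfolding w .
qed

text \<open>An occurrence of the pattern needs three distinct letters.\<close>

lemma shaped_two_letters:
  assumes "is_RGF w" "set w \<subseteq> {1, 2}"
  shows "\<exists>s. shaped s w"
proof (rule shaped_exists[OF assms(1)])
  show "\<not> contains_1232 w"
  proof
    assume "contains_1232 w"
    then obtain a b c d where abcd: "a < b" "b < c" "c < d" "d < length w"
      and ne: "w ! a \<noteq> w ! b" "w ! c \<noteq> w ! b" "w ! a \<noteq> w ! c"
      unfolding contains_1232_def by blast
    have two: "w ! i = 1 \<or> w ! i = 2" if "i < length w" for i
      using assms(2) nth_mem[OF that] by blast
    have "a < length w" "b < length w" "c < length w" using abcd by linarith+
    from this[THEN two] ne show False by auto
  qed
qed

text \<open>The word is read in three stretches: the sorted \<open>u\<close>, the ones, and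
  \<open>v\<close>. The first letter of \<open>v\<close> is forced to be a new maximum, and from
  there on \<open>shaped_append_sorted\<close> applies.\<close>

lemma shaped_increasing_with_inserted_ones:
  assumes "is_RGF w" "increasing_with_inserted_ones w"
  shows "\<exists>s. shaped s w"
proof -
  obtain u v j where w: "w = u @ replicate j 1 @ v" "sorted (u @ v)" "u \<noteq> []"
    "v = [] \<or> last u \<noteq> hd v"
    using assms(2) by (auto simp: increasing_with_inserted_ones_def)
  let ?p = "u @ replicate j 1"
  have "is_RGF u" using assms(1) w(1,3) is_RGF_prefix by blast
  moreover have "sorted u" using w(2) by (simp add: sorted_append)
  ultimately obtain s where "s \<in> {Ones, Sorted12, Increasing}" "shaped s u"
    using shaped_sorted by blast
  then have "shaped s u" "s \<noteq> Resumed" by auto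
  then obtain t where t: "shaped t ?p"
    using shaped_append_ones by blast
  show ?thesis
  proof (cases v)
    case Nil
    with t w(1) show ?thesis by auto
  next
    case (Cons x v')
    let ?M = "Max (set ?p)"
    have RGF: "is_RGF ((?p @ [x]) @ v')" using assms(1) w(1) Cons by simp
    then have "is_RGF (?p @ [x])" by (rule is_RGF_prefix) simp
    then have x: "x \<le> Suc ?M" using w(3) by (subst (asm) is_RGF_snoc) auto
    have u: "\<forall>a \<in> set u. a \<le> last u"
      using w(2,3) by (cases u rule: rev_cases) (auto simp: sorted_append)
    have "1 \<le> last u"
      using \<open>is_RGF u\<close> w(3) by (simp add: is_RGF_def)
    with u have "?M \<le> last u" using w(3) by (intro Max.boundedI) auto
    moreover have "last u < x"
      using w(2,3,4) Cons by (auto simp: sorted_append order_less_le)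
    \<comment> \<open>The chain \<open>?M \<le> last u < x \<le> Suc ?M\<close> leaves one
      value.\<close>
    ultimately have xM: "x = Suc ?M" using x by linarith
    have t': "shaped (after_new t) (?p @ [x])" unfolding xM using t by (rule new)
    have "Max (set (?p @ [x])) = x"
    proof (rule Max_eqI)
      fix y assume "y \<in> set (?p @ [x])"
      then have "y \<in> set ?p \<or> y = x" by auto
      then show "y \<le> x" unfolding xM 
        using Max_ge[OF finite_set, of y ?p] le_SucI by blast
    qed simp_all
    moreover have "\<forall>a \<in> set v'. x \<le> a"
      using w(2) Cons by (auto simp: sorted_append)
    moreover have "sorted v'" using w(2) Cons by (auto simp: sorted_append)
    moreover note after_new_not_Ones_Tail
    ultimately have "\<exists>s \<in> - {Ones_Tail}. shaped s ((?p @ [x]) @ v')"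
      using RGF by (intro shaped_append_sorted[OF t']) auto
    then show ?thesis using w(1) Cons by auto
  qed
qed

text \<open>A word in 1 and 2 cannot end in \<open>Ones_Tail\<close>, which has maximum at least 3,
  and all letters of \<open>v\<close> exceed the maximum of \<open>u\<close>.\<close>

lemma shaped_ones_twos_then_increasing:
  assumes "is_RGF w" "ones_twos_then_increasing w"
  shows "\<exists>s. shaped s w"
proof -
  obtain u v where w: "w = u @ v" "set u \<subseteq> {1, 2}" "v \<noteq> []" "hd v = 3" "sorted v"
    using assms(2) by (auto simp: ones_twos_then_increasing_def)
  \<comment> \<open>A growth function starts with 1, whereas \<open>v\<close> starts with 3.\<close>
  have u: "u \<noteq> []"
    using assms(1) w(1,3,4) by (auto simp: is_RGF_def hd_conv_nth)
  then have "is_RGF u" using assms(1) w(1) is_RGF_prefix by blast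
  then obtain s where s: "shaped s u" using shaped_two_letters w(2) by blast
  have M: "Max (set u) \<le> 2" using w(2) u by (intro Max.boundedI) auto
  then have "s \<noteq> Ones_Tail" using shaped_Max(4)[OF s] by auto
  moreover have "\<forall>a \<in> set v. 3 \<le> a"
    using w(3-5) by (cases v) auto
  moreover note after_new_not_Ones_Tail
  ultimately have "\<exists>t \<in> - {Ones_Tail}. shaped t (u @ v)"
    using M assms(1) w(1,5) by (intro shaped_append_sorted[OF s]) auto
  then show ?thesis using w(1) by blast
qed

lemma shaped_iff_form:
  assumes "is_RGF w"
  shows "(\<exists>s. shaped s w) \<longleftrightarrow>
    (let m = Max (set w) in m \<le> 2 \<or> (m \<ge> 3 \<and> increasing_with_inserted_ones w)
      \<or> (m \<ge> 3 \<and> ones_twos_then_increasing w))" (is "?L \<longleftrightarrow> ?R")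
proof
  assume ?L
  then obtain s where s: "shaped s w" by blast
  have iff: "increasing_with_inserted_ones w" if "w = u @ replicate j 1 @ v"
    "sorted (u @ v)" "u \<noteq> []" "v = [] \<or> last u \<noteq> hd v" for u j v
    using that unfolding increasing_with_inserted_ones_def by blast
  have ne: "w \<noteq> []" using shaped_Max(1)[OF s] .
  show ?R
  proof (cases s)
    case Increasing
    then have "sorted w" using shaped_form[OF s] by simp
    \<comment> \<open>A weakly increasing word carries an empty block of ones at its end.\<close>
    then have "increasing_with_inserted_ones w" using iff[of w 0 "[]"] ne by simp
    then show ?thesis using Increasing shaped_Max(4)[OF s] by (simp add: Let_def)
  next
    case Ones_Tail
    then obtain u j where "w = u @ replicate j 1" "sorted u" "u \<noteq> []"
      using shaped_form[OF s] by auto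
    then have "increasing_with_inserted_ones w" using iff[of u j "[]"] by simp
    then show ?thesis using Ones_Tail shaped_Max(4)[OF s] by (simp add: Let_def)
  next
    case Resumed
    then have "ones_twos_then_increasing w \<or> increasing_with_inserted_ones w"
      using shaped_form[OF s] iff unfolding split_by_ones_def by blast
    then show ?thesis using Resumed shaped_Max(4)[OF s] by (auto simp: Let_def)
  qed (use shaped_Max(4)[OF s] in \<open>simp_all add: Let_def\<close>)
next
  assume ?R
  then consider "Max (set w) \<le> 2" | "increasing_with_inserted_ones w" | "ones_twos_then_increasing w"
    by (auto simp: Let_def)
  then show ?L
  proof cases
    case 1
    have "a = 1 \<or> a = 2" if "a \<in> set w" for a
    proof -
      have "1 \<le> a" using assms that by (simp add: is_RGF_def)
      moreover have "a \<le> 2" using Max_ge[OF finite_set that] 1 by linarith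
      ultimately show ?thesis by linarith
    qed
    then show ?thesis using assms by (intro shaped_two_letters) auto
  qed (use assms shaped_increasing_with_inserted_ones shaped_ones_twos_then_increasing in blast)+
qed

section \<open>Partitions and restricted growth functions\<close>

lemma set_RGF: "is_RGF w \<Longrightarrow> set w = {1..Max (set w)}"
proof (induction w rule: rev_induct)
  case (snoc x w)
  show ?case
  proof (cases "w = []")
    case True
    then show ?thesis using snoc.prems by simp
  next
    case False
    let ?M = "Max (set w)"
    have w: "set w = {1..?M}" and x: "1 \<le> x" "x \<le> Suc ?M"
      using snoc False by (auto simp: is_RGF_snoc)
    have "Max (set (w @ [x])) = max x ?M" using False by simp
    moreover have "insert x {1..?M} = {1..max x ?M}" using x by auto
    ultimately show ?thesis using w by simp
  qed
qed (simp add: is_RGF_def)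

text \<open>A last letter that occurs earlier is fixed by its earlier copy; one that does not must
  be the maximum plus one.\<close>

lemma RGF_eqI:
  assumes "is_RGF v" "is_RGF w" "length v = length w"
    and "\<And>i j. i < length v \<Longrightarrow> j < length v \<Longrightarrow> v ! i = v ! j \<longleftrightarrow> w ! i = w ! j"
  shows "v = w"
  using assms
proof (induction v arbitrary: w rule: rev_induct)
  case Nil
  then show ?case by simp
next
  case (snoc x v)
  then obtain y u where w: "w = u @ [y]" by (cases w rule: rev_cases) auto
  have len: "length v = length u" using snoc.prems(3) w by simp
  show ?case
  proof (cases "v = []")
    case True
    then show ?thesis using snoc.prems(1,2) len w by simp
  next
    case False
    then have ne: "u \<noteq> []" using len by auto
    have RGF: "is_RGF v" "1 \<le> x" "x \<le> Suc (Max (set v))" "is_RGF u" "1 \<le> y" "y \<le> Suc (Max (set u))"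
      using snoc.prems(1,2) False ne w by (simp_all add: is_RGF_snoc)
    have "v = u"
    proof (rule snoc.IH[OF RGF(1,4) len])
      fix i j assume "i < length v" "j < length v"
      then show "v ! i = v ! j \<longleftrightarrow> u ! i = u ! j"
        using snoc.prems(4)[of i j] len w by (simp add: nth_append)
    qed
    have *: "v ! i = x \<longleftrightarrow> v ! i = y" if "i < length v" for i
      using snoc.prems(4)[of i "length v"] that w \<open>v = u\<close> by (simp add: nth_append)
    have "x = y"
    proof (cases "x \<in> set v \<or> y \<in> set v")
      case True
      then show ?thesis using * by (auto simp: in_set_conv_nth)
    next
      case False
      then have "x \<notin> {1..Max (set v)}" "y \<notin> {1..Max (set v)}"
        using set_RGF[OF RGF(1)] by simp_all
      then show ?thesis using RGF(2,3,5,6) \<open>v = u\<close> by simp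
    qed
    then show ?thesis using \<open>v = u\<close> w by simp
  qed
qed

section \<open>The growth function of a set partition\<close>

lemma partition_on_block:
  assumes "partition_on A \<sigma>" "x \<in> A"
  shows "(THE B. B \<in> \<sigma> \<and> x \<in> B) \<in> \<sigma>" "x \<in> (THE B. B \<in> \<sigma> \<and> x \<in> B)"
proof -
  have "\<exists>!B. B \<in> \<sigma> \<and> x \<in> B"
    using assms by (auto simp: partition_on_def disjoint_def)
  from theI'[OF this] show "(THE B. B \<in> \<sigma> \<and> x \<in> B) \<in> \<sigma>" "x \<in> (THE B. B \<in> \<sigma> \<and> x \<in> B)"
    by auto
qed

context
  fixes n :: nat and \<sigma> :: "nat set set"
  assumes partition: "partition_on {1..n} \<sigma>"
begin

definition "block x = (THE B. B \<in> \<sigma> \<and> x \<in> B)"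

lemma block_props:
  assumes "B \<in> \<sigma>"
  shows "finite B" "B \<noteq> {}" "B \<subseteq> {1..n}"
proof -
  show "B \<subseteq> {1..n}" using partition_onD1[OF partition] assms by blast
  then show "finite B" by (rule finite_subset) simp
  show "B \<noteq> {}" using partition_onD3[OF partition] assms by blast
qed

lemma finite_partition: "finite \<sigma>"
  using partition finite_elements by blast

lemma block_unique: "B \<in> \<sigma> \<Longrightarrow> C \<in> \<sigma> \<Longrightarrow> x \<in> B \<Longrightarrow> x \<in> C \<Longrightarrow> B = C"
  using partition by (auto simp: partition_on_def disjoint_def)

lemma Min_block: "B \<in> \<sigma> \<Longrightarrow> Min B \<in> B"
  using block_props by simp

text \<open>Disjoint blocks have distinct minima, and the index grows strictly with the
  minimum.\<close>

lemma block_index_inject: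
  assumes "B \<in> \<sigma>" "C \<in> \<sigma>"
  shows "block_index \<sigma> B = block_index \<sigma> C \<longleftrightarrow> B = C"
proof -
  have less: "block_index \<sigma> B < block_index \<sigma> C" if "C \<in> \<sigma>" "Min B < Min C" for B C
    unfolding block_index_def
  proof (rule psubset_card_mono)
    show "{D \<in> \<sigma>. Min D \<le> Min B} \<subset> {D \<in> \<sigma>. Min D \<le> Min C}"
    proof (rule psubsetI)
      have "C \<in> {D \<in> \<sigma>. Min D \<le> Min C}" "C \<notin> {D \<in> \<sigma>. Min D \<le> Min B}" using that by simp_all
      then show "{D \<in> \<sigma>. Min D \<le> Min B} \<noteq> {D \<in> \<sigma>. Min D \<le> Min C}" by blast
    qed (use that in auto)
  qed (simp add: finite_partition)
  show ?thesis
  proof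
    assume "block_index \<sigma> B = block_index \<sigma> C"
    then have "Min B = Min C" using less[of C B] less[of B C] assms by fastforce
    then show "B = C" using block_unique[OF assms] Min_block[OF assms(1)] Min_block[OF assms(2)] by simp
  qed simp
qed

lemma length_RGF_of: "length (RGF_of n \<sigma>) = n"
  by (simp add: RGF_of_def)

lemma nth_RGF_of: "i < n \<Longrightarrow> RGF_of n \<sigma> ! i = block_index \<sigma> (block (Suc i))"
  by (simp add: RGF_of_def block_def nth_append del: upt_Suc)

lemma block: "1 \<le> x \<Longrightarrow> x \<le> n \<Longrightarrow> block x \<in> \<sigma>" "1 \<le> x \<Longrightarrow> x \<le> n \<Longrightarrow> x \<in> block x"
  unfolding block_def using partition_on_block[OF partition, of x] by auto

lemma RGF_of_eq_iff:
  assumes "i < n" "j < n"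
  shows "RGF_of n \<sigma> ! i = RGF_of n \<sigma> ! j \<longleftrightarrow> (\<exists>B \<in> \<sigma>. Suc i \<in> B \<and> Suc j \<in> B)"
proof -
  have "block (Suc i) \<in> \<sigma>" "block (Suc j) \<in> \<sigma>" "Suc i \<in> block (Suc i)" "Suc j \<in> block (Suc j)"
    using block assms by simp_all
  then show ?thesis
    using assms block_unique by (simp add: nth_RGF_of block_index_inject) metis
qed

text \<open>A position that is not the minimum of its block repeats an earlier letter; one that is
  adds just this block to those already opened.\<close>

lemma is_RGF_RGF_of:
  assumes "n \<ge> 1"
  shows "is_RGF (RGF_of n \<sigma>)"
proof -
  let ?w = "RGF_of n \<sigma>"
  have block_eq: "block x = B" if "B \<in> \<sigma>" "x \<in> B" for x B
  proof -
    have "1 \<le> x" "x \<le> n" using block_props(3)[OF that(1)] that(2) by auto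
    then show ?thesis using block block_unique that by blast
  qed
  have Min_pos: "1 \<le> Min B" "Min B \<le> n" if "B \<in> \<sigma>" for B
    using block_props(3)[OF that] Min_block[OF that] by auto
  have "?w \<noteq> []" using length_RGF_of assms by auto
  moreover have "\<forall>a \<in> set ?w. 1 \<le> a"
  proof
    fix a assume "a \<in> set ?w"
    then obtain i where "i < n" "a = ?w ! i" by (metis in_set_conv_nth length_RGF_of)
    then have a: "a = block_index \<sigma> (block (Suc i))" and "block (Suc i) \<in> \<sigma>"
      using nth_RGF_of block by simp_all
    then have "{C \<in> \<sigma>. Min C \<le> Min (block (Suc i))} \<noteq> {}" by auto
    then show "1 \<le> a"
      unfolding a block_index_def by (simp add: finite_partition card_gt_0_iff Suc_le_eq)
  qed
  moreover have "?w ! 0 = 1"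
  proof -
    have B: "block 1 \<in> \<sigma>" "1 \<in> block 1" using block assms by simp_all
    have M: "Min (block 1) = 1"
      using Min_le[OF block_props(1)[OF B(1)] B(2)] Min_pos(1)[OF B(1)] by (rule order_antisym)
    have C: "C = block 1" if "C \<in> \<sigma>" "Min C \<le> 1" for C
    proof -
      have "Min C = 1" using Min_pos(1)[OF that(1)] that(2) by (rule order_antisym[rotated])
      then have "1 \<in> C" using Min_block[OF that(1)] by simp
      with that(1) show ?thesis using block_eq by metis
    qed
    have "{C \<in> \<sigma>. Min C \<le> 1} = {block 1}"
    proof (rule subset_antisym)
      show "{C \<in> \<sigma>. Min C \<le> 1} \<subseteq> {block 1}" by (clarify, rule C)
      show "{block 1} \<subseteq> {C \<in> \<sigma>. Min C \<le> 1}" using B(1) M by simp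
    qed
    then have "{C \<in> \<sigma>. Min C \<le> Min (block 1)} = {block 1}" unfolding M .
    then show ?thesis using nth_RGF_of[of 0] assms by (simp add: block_index_def)
  qed
  moreover have "?w ! i \<le> 1 + Max (set (take i ?w))" if i: "1 \<le> i" "i < n" for i
  proof -
    let ?B = "block (Suc i)"
    have B: "?B \<in> \<sigma>" "Suc i \<in> ?B" using block i by simp_all
    \<comment> \<open>Such a block has put its index among the first \<open>i\<close> letters, at
      position \<open>Min C - 1\<close>.\<close>
    have earlier: "block_index \<sigma> C \<le> Max (set (take i ?w))" if "C \<in> \<sigma>" "Min C \<le> i" for C
    proof (rule Max_ge)
      have "?w ! (Min C - 1) = block_index \<sigma> C"
        using nth_RGF_of[of "Min C - 1"] Min_pos[OF that(1)] block_eq[OF that(1) Min_block[OF that(1)]]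
        by simp
      moreover have "Min C - 1 < length (take i ?w)"
        using that(2) i Min_pos[OF that(1)] by (simp add: length_RGF_of)
      ultimately show "block_index \<sigma> C \<in> set (take i ?w)"
        by (metis nth_mem nth_take length_take min_less_iff_conj)
    qed simp
    have "Min ?B \<le> Suc i" using block_props(1)[OF B(1)] B(2) by (rule Min_le)
    show ?thesis
    proof (cases "Min ?B \<le> i")
      case True
      then show ?thesis using earlier[OF B(1)] nth_RGF_of[OF i(2)] by simp
    next
      case False
      let ?S = "{C \<in> \<sigma>. Min C \<le> i}"
      have M: "Min ?B = Suc i" using False \<open>Min ?B \<le> Suc i\<close> by simp
      have "C = ?B" if "C \<in> \<sigma>" "Min C = Suc i" for C
        using block_eq[of C "Suc i"] Min_block[OF that(1)] that by simp
      then have "{C \<in> \<sigma>. Min C \<le> Suc i} \<subseteq> insert ?B ?S"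
        by (auto simp: le_Suc_eq)
      then have "block_index \<sigma> ?B \<le> card (insert ?B ?S)"
        unfolding block_index_def M by (intro card_mono) (simp_all add: finite_partition)
      also have "\<dots> \<le> 1 + card ?S" by (simp add: card_insert_if finite_partition)
      finally have 1: "block_index \<sigma> ?B \<le> 1 + card ?S" .
      have "block 1 \<in> \<sigma>" "1 \<in> block 1" using block assms by simp_all
      then have "block 1 \<in> ?S"
        using Min_le[OF block_props(1), of "block 1" 1] i(1) by simp
      then have "Min ` ?S \<noteq> {}" "finite (Min ` ?S)" using finite_partition by auto
      \<comment> \<open>\<open>D\<close> is the block of \<open>?S\<close> opened last, so its index
        counts all of \<open>?S\<close>.\<close>
      from Max_in[OF this(2,1)] obtain D where D: "D \<in> \<sigma>" "Min D \<le> i" "Max (Min ` ?S) = Min D"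
        by auto
      have "?S \<subseteq> {C \<in> \<sigma>. Min C \<le> Min D}"
        using D(3) \<open>finite (Min ` ?S)\<close> by (metis (mono_tags, lifting) Max_ge image_eqI mem_Collect_eq subsetI)
      then have "card ?S \<le> block_index \<sigma> D"
        unfolding block_index_def by (intro card_mono) (simp_all add: finite_partition)
      then show ?thesis using 1 earlier[OF D(1,2)] nth_RGF_of[OF i(2)] by simp
    qed
  qed
  ultimately show ?thesis
    by (simp add: is_RGF_def length_RGF_of)
qed

lemma block_eq_positions:
  assumes "B \<in> \<sigma>" "x \<in> B"
  shows "B = {y \<in> {1..n}. RGF_of n \<sigma> ! (y - 1) = RGF_of n \<sigma> ! (x - 1)}"
proof -
  have x: "1 \<le> x" "x \<le> n" using block_props(3)[OF assms(1)] assms(2) by auto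
  have "y \<in> B \<longleftrightarrow> RGF_of n \<sigma> ! (y - 1) = RGF_of n \<sigma> ! (x - 1)" if "1 \<le> y" "y \<le> n" for y
  proof -
    have "RGF_of n \<sigma> ! (y - 1) = RGF_of n \<sigma> ! (x - 1) \<longleftrightarrow> (\<exists>B \<in> \<sigma>. y \<in> B \<and> x \<in> B)"
      using RGF_of_eq_iff[of "y - 1" "x - 1"] that x by simp
    then show ?thesis using assms block_unique by blast
  qed
  then show ?thesis using block_props(3)[OF assms(1)] by auto
qed

end

section \<open>Set partitions correspond bijectively to restricted growth functions\<close>

lemma RGF_of_subset:
  assumes "partition_on {1..n} \<sigma>" "partition_on {1..n} \<tau>" "RGF_of n \<sigma> = RGF_of n \<tau>"
  shows "\<sigma> \<subseteq> \<tau>"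
proof
  fix B assume B: "B \<in> \<sigma>"
  then obtain x where x: "x \<in> B" "1 \<le> x" "x \<le> n"
    using block_props[OF assms(1) B] by fastforce
  have C: "block \<tau> x \<in> \<tau>" "x \<in> block \<tau> x"
    using block[OF assms(2) x(2,3)] by simp_all
  \<comment> \<open>Each side is the set of positions carrying the letter of \<open>x\<close>, and
    the two words agree.\<close>
  have "B = block \<tau> x"
    unfolding block_eq_positions[OF assms(1) B x(1)] block_eq_positions[OF assms(2) C] assms(3) ..
  with C show "B \<in> \<tau>" by simp
qed

lemma inj_on_RGF_of: "inj_on (RGF_of n) {\<sigma>. partition_on {1..n} \<sigma>}"
  by (intro inj_onI subset_antisym RGF_of_subset) auto

text \<open>Restricted growth functions with the same pattern of equal letters coincide, so the block
  indices of the partition into letter positions need not be computed.\<close>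

lemma RGF_of_surj:
  assumes "is_RGF w"
  obtains \<sigma> where "partition_on {1..length w} \<sigma>" "RGF_of (length w) \<sigma> = w"
proof
  let ?n = "length w"
  define positions where "positions a = {x \<in> {1..?n}. w ! (x - 1) = a}" for a
  let ?\<sigma> = "positions ` set w"
  show P: "partition_on {1..?n} ?\<sigma>"
  proof (rule partition_onI)
    show "\<Union>?\<sigma> = {1..?n}" by (auto simp: positions_def)
    show "disjnt p q" if "p \<in> ?\<sigma>" "q \<in> ?\<sigma>" "p \<noteq> q" for p q
      using that by (auto simp: positions_def disjnt_def)
    show "{} \<notin> ?\<sigma>"
    proof
      assume "{} \<in> ?\<sigma>"
      then obtain i where i: "i < ?n" "{} = positions (w ! i)"
        by (auto simp: in_set_conv_nth)
      then have "Suc i \<in> {}" unfolding i(2) by (simp add: positions_def)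
      then show False by simp
    qed
  qed
  have "?n \<ge> 1" using assms by (cases w) (auto simp: is_RGF_def)
  show "RGF_of ?n ?\<sigma> = w"
  proof (rule RGF_eqI[OF is_RGF_RGF_of[OF P \<open>?n \<ge> 1\<close>] assms])
    show "length (RGF_of ?n ?\<sigma>) = ?n" using length_RGF_of[OF P] .
    fix i j assume "i < length (RGF_of ?n ?\<sigma>)" "j < length (RGF_of ?n ?\<sigma>)"
    then have ij: "i < ?n" "j < ?n" by (simp_all add: length_RGF_of[OF P])
    have "(\<exists>B \<in> ?\<sigma>. Suc i \<in> B \<and> Suc j \<in> B) \<longleftrightarrow> w ! i = w ! j"
      using ij nth_mem by (auto simp: positions_def)
    then show "RGF_of ?n ?\<sigma> ! i = RGF_of ?n ?\<sigma> ! j \<longleftrightarrow> w ! i = w ! j"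
      unfolding RGF_of_eq_iff[OF P ij] .
  qed
qed

section \<open>Standardization and occurrences of the pattern\<close>

lemma rank_in_mono: "finite A \<Longrightarrow> x \<le> y \<Longrightarrow> rank_in A x \<le> rank_in A y"
  unfolding rank_in_def by (intro card_mono) auto

lemma rank_in_less_imp_less: "finite A \<Longrightarrow> rank_in A x < rank_in A y \<Longrightarrow> x < y"
  using rank_in_mono by (meson leD leI)

lemma Union_subpartition:
  assumes "A \<subseteq> \<Union>\<sigma>"
  shows "\<Union>(subpartition A \<sigma>) = A"
proof (rule subset_antisym)
  show "\<Union>(subpartition A \<sigma>) \<subseteq> A" by (auto simp: subpartition_def)
  show "A \<subseteq> \<Union>(subpartition A \<sigma>)"
  proof
    fix x assume "x \<in> A"
    then obtain B where "B \<in> \<sigma>" "x \<in> A \<inter> B" using assms by blast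
    then have "x \<in> A \<inter> B" "A \<inter> B \<in> subpartition A \<sigma>" unfolding subpartition_def by blast+
    then show "x \<in> \<Union>(subpartition A \<sigma>)" by (rule UnionI[rotated])
  qed
qed

text \<open>Ranks reflect the order, so elements of ranks 1, 2, 3, 4 are increasing; the blocks of
  the pattern pull back to blocks of \<open>\<sigma>\<close>, where sharing a block means equal
  letters.\<close>

lemma contains_1232_if_contains_pattern:
  assumes P: "partition_on {1..n} \<sigma>" and "contains_pattern \<sigma> pattern_1_24_3"
  shows "contains_1232 (RGF_of n \<sigma>)"
proof -
  obtain A where A: "A \<subseteq> \<Union>\<sigma>" "standardize (subpartition A \<sigma>) = pattern_1_24_3"
    using assms(2) by (auto simp: contains_pattern_def)
  have An: "A \<subseteq> {1..n}" using A(1) partition_onD1[OF P] by simp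
  then have fin: "finite A" by (rule finite_subset) simp
  have std: "(\<lambda>B. rank_in A ` B) ` subpartition A \<sigma> = {{1}, {2, 4}, {3}}"
    using A(2) unfolding standardize_def Union_subpartition[OF A(1)] pattern_1_24_3_def .
  have lift: "\<exists>B \<in> \<sigma>. rank_in A ` (A \<inter> B) = R" if "R \<in> {{1}, {2, 4}, {3}}" for R
    using that unfolding std[symmetric] by (auto simp: subpartition_def)
  obtain B1 where B1: "B1 \<in> \<sigma>" "rank_in A ` (A \<inter> B1) = {1}" using lift by blast
  obtain B2 where B2: "B2 \<in> \<sigma>" "rank_in A ` (A \<inter> B2) = {2, 4}" using lift by blast
  obtain B3 where B3: "B3 \<in> \<sigma>" "rank_in A ` (A \<inter> B3) = {3}" using lift by blast
  have pick: "\<exists>x \<in> A. x \<in> B \<and> rank_in A x = r" if "r \<in> rank_in A ` (A \<inter> B)" for r B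
    using that by auto
  obtain a where a: "a \<in> A" "a \<in> B1" "rank_in A a = 1" using pick[of 1 B1] unfolding B1(2) by auto
  obtain b where b: "b \<in> A" "b \<in> B2" "rank_in A b = 2" using pick[of 2 B2] unfolding B2(2) by auto
  obtain d where d: "d \<in> A" "d \<in> B2" "rank_in A d = 4" using pick[of 4 B2] unfolding B2(2) by auto
  obtain c where c: "c \<in> A" "c \<in> B3" "rank_in A c = 3" using pick[of 3 B3] unfolding B3(2) by auto
  have "a < b" "b < c" "c < d"
    by (rule rank_in_less_imp_less[OF fin], simp add: a b c d)+
  moreover have range: "1 \<le> a" "a \<le> n" "1 \<le> b" "b \<le> n" "1 \<le> c" "c \<le> n" "1 \<le> d" "d \<le> n"
    using An a b c d by auto
  have same: "RGF_of n \<sigma> ! (x - 1) = RGF_of n \<sigma> ! (y - 1) \<longleftrightarrow> (\<exists>B \<in> \<sigma>. x \<in> B \<and> y \<in> B)"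
    if "1 \<le> x" "x \<le> n" "1 \<le> y" "y \<le> n" for x y
    using RGF_of_eq_iff[OF P, of "x - 1" "y - 1"] that by simp
  \<comment> \<open>A block containing both would be \<open>B\<close>, and the rank of
    \<open>y\<close> would lie in the image of \<open>A \<inter> B\<close>.\<close>
  have diff: "\<not> (\<exists>C \<in> \<sigma>. x \<in> C \<and> y \<in> C)"
    if "B \<in> \<sigma>" "x \<in> B" "y \<in> A" "rank_in A y \<notin> rank_in A ` (A \<inter> B)" for B x y
    using that block_unique[OF P] by blast
  have "\<not> (\<exists>C \<in> \<sigma>. a \<in> C \<and> b \<in> C)" "\<not> (\<exists>C \<in> \<sigma>. a \<in> C \<and> c \<in> C)" "\<not> (\<exists>C \<in> \<sigma>. c \<in> C \<and> b \<in> C)"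
    using diff[OF B1(1) a(2) b(1)] diff[OF B1(1) a(2) c(1)] diff[OF B3(1) c(2) b(1)]
    unfolding B1(2) B3(2) b(3) c(3) by simp_all
  moreover have "\<exists>C \<in> \<sigma>. b \<in> C \<and> d \<in> C" using B2(1) b d by blast
  ultimately have "a - 1 < b - 1" "b - 1 < c - 1" "c - 1 < d - 1" "d - 1 < n"
    "RGF_of n \<sigma> ! (b - 1) = RGF_of n \<sigma> ! (d - 1)"
    "RGF_of n \<sigma> ! (a - 1) \<noteq> RGF_of n \<sigma> ! (b - 1)"
    "RGF_of n \<sigma> ! (c - 1) \<noteq> RGF_of n \<sigma> ! (b - 1)"
    "RGF_of n \<sigma> ! (a - 1) \<noteq> RGF_of n \<sigma> ! (c - 1)"
    using range by (simp_all only: same simp_thms)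
  then show ?thesis
    unfolding contains_1232_def length_RGF_of[OF P] by blast
qed

lemma contains_pattern_if_contains_1232:
  assumes P: "partition_on {1..n} \<sigma>" and "contains_1232 (RGF_of n \<sigma>)"
  shows "contains_pattern \<sigma> pattern_1_24_3"
proof -
  obtain i j k l where less: "i < j" "j < k" "k < l" "l < n"
    and eq: "RGF_of n \<sigma> ! j = RGF_of n \<sigma> ! l"
    and ne: "RGF_of n \<sigma> ! i \<noteq> RGF_of n \<sigma> ! j" "RGF_of n \<sigma> ! k \<noteq> RGF_of n \<sigma> ! j"
      "RGF_of n \<sigma> ! i \<noteq> RGF_of n \<sigma> ! k"
    using assms(2) unfolding contains_1232_def length_RGF_of[OF P] by blast
  \<comment> \<open>Word positions start at 0, elements of the ground set at 1.\<close>
  define a b c d where "a = Suc i" and "b = Suc j" and "c = Suc k" and "d = Suc l"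
  note abcd = a_def b_def c_def d_def
  have lt: "a < b" "b < c" "c < d" using less by (simp_all add: abcd)
  have le: "i < n" "j < n" "k < n" "l < n" using less by simp_all
  have diff: "\<not> (\<exists>C \<in> \<sigma>. a \<in> C \<and> b \<in> C)" "\<not> (\<exists>C \<in> \<sigma>. c \<in> C \<and> b \<in> C)" "\<not> (\<exists>C \<in> \<sigma>. a \<in> C \<and> c \<in> C)"
    using ne le by (simp_all add: abcd RGF_of_eq_iff[OF P])
  obtain B where B: "B \<in> \<sigma>" "b \<in> B" "d \<in> B"
    using eq le by (auto simp: abcd RGF_of_eq_iff[OF P])
  have range: "1 \<le> a" "a \<le> n" "1 \<le> c" "c \<le> n" using le by (simp_all add: abcd)
  obtain Ba Bc where Ba: "Ba \<in> \<sigma>" "a \<in> Ba" and Bc: "Bc \<in> \<sigma>" "c \<in> Bc"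
    using block[OF P range(1,2)] block[OF P range(3,4)] by blast
  let ?A = "{a, b, c, d}"
  have ne: "Ba \<noteq> B" "Bc \<noteq> B" "Ba \<noteq> Bc"
    using diff B(1,2) Ba Bc by auto
  note unique = block_unique[OF P]
  have notin: "a \<notin> B" "a \<notin> Bc" "b \<notin> Ba" "b \<notin> Bc" "c \<notin> Ba" "c \<notin> B" "d \<notin> Ba" "d \<notin> Bc"
    using ne unique[OF Ba(1) B(1)] unique[OF Bc(1) B(1)] unique[OF Ba(1) Bc(1)] B(2,3) Ba(2) Bc(2)
    by metis+
  have inter: "?A \<inter> Ba = {a}" "?A \<inter> B = {b, d}" "?A \<inter> Bc = {c}"
    using notin B(2,3) Ba(2) Bc(2) by auto
  \<comment> \<open>Each element of \<open>?A\<close> lies in one of the three chosen blocks, so no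
    other block meets \<open>?A\<close>.\<close>
  have C: "C = Ba \<or> C = B \<or> C = Bc" if C: "C \<in> \<sigma>" "?A \<inter> C \<noteq> {}" for C
  proof -
    have "a \<in> C \<or> b \<in> C \<or> c \<in> C \<or> d \<in> C" using C(2) by auto
    then show ?thesis
      using unique[OF C(1) Ba(1) _ Ba(2)] unique[OF C(1) B(1) _ B(2)] unique[OF C(1) B(1) _ B(3)]
        unique[OF C(1) Bc(1) _ Bc(2)] by metis
  qed
  have sub: "subpartition ?A \<sigma> = {{a}, {b, d}, {c}}"
  proof (rule subset_antisym; rule subsetI)
    fix X assume "X \<in> subpartition ?A \<sigma>"
    then obtain D where D: "X = ?A \<inter> D" "D \<in> \<sigma>" "?A \<inter> D \<noteq> {}"
      unfolding subpartition_def by blast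
    from C[OF D(2,3)] show "X \<in> {{a}, {b, d}, {c}}"
      unfolding D(1) using inter by (elim disjE) (simp_all only: insert_iff simp_thms)
  next
    have mem: "?A \<inter> D \<in> subpartition ?A \<sigma>" if "D \<in> \<sigma>" "?A \<inter> D \<noteq> {}" for D
      using that unfolding subpartition_def by blast
    fix X assume "X \<in> {{a}, {b, d}, {c}}"
    then show "X \<in> subpartition ?A \<sigma>"
      using mem[OF Ba(1)] mem[OF B(1)] mem[OF Bc(1)] unfolding inter by auto
  qed
  have A: "?A \<subseteq> \<Union>\<sigma>" using B Ba Bc by blast
  have "{y \<in> ?A. y \<le> a} = {a}" "{y \<in> ?A. y \<le> b} = {a, b}" "{y \<in> ?A. y \<le> c} = {a, b, c}"
    "{y \<in> ?A. y \<le> d} = {a, b, c, d}"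
    using lt by auto
  then have "rank_in ?A a = 1" "rank_in ?A b = 2" "rank_in ?A c = 3" "rank_in ?A d = 4"
    using lt by (simp_all only: rank_in_def) auto
  then have "standardize (subpartition ?A \<sigma>) = pattern_1_24_3"
    unfolding standardize_def Union_subpartition[OF A] unfolding sub pattern_1_24_3_def
    by (simp only: image_insert image_empty)
  with A show ?thesis
    unfolding contains_pattern_def by blast
qed

theorem theorem3p10:
  fixes n :: nat
  assumes "n \<ge> 1"
  shows "avoiding_RGFs n pattern_1_24_3 =
           {w. is_RGF w \<and> length w = n \<and>
               (let m = Max (set w) in
                  m \<le> 2 \<or>
                  (m \<ge> 3 \<and> increasing_with_inserted_ones w) \<or>
                  (m \<ge> 3 \<and> ones_twos_then_increasing w))}
       \<and> card (avoiding_partitions n pattern_1_24_3) =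
           2 ^ (n - 1)
           + (\<Sum>m = 3..n. (n - 1) choose (n - m))
           + (\<Sum>m = 3..n - 1. \<Sum>k = m - 1..n - 2.
                ((k - 1) choose (k + 1 - m))
                  * ((2 ^ (n - k - 1) - 1) + (m - 2) * (n - k - 1)))"
proof
  \<comment> \<open>Moves the problem from partitions to words, for both parts.\<close>
  have image: "avoiding_RGFs n pattern_1_24_3 = {w. is_RGF w \<and> length w = n \<and> \<not> contains_1232 w}"
    (is "_ = ?R")
  proof (rule subset_antisym; rule subsetI)
    fix w assume "w \<in> avoiding_RGFs n pattern_1_24_3"
    then obtain \<sigma> where P: "partition_on {1..n} \<sigma>" and "\<not> contains_pattern \<sigma> pattern_1_24_3"
      and w: "w = RGF_of n \<sigma>"
      unfolding avoiding_RGFs_def avoiding_partitions_def by blast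
    then show "w \<in> ?R"
      using is_RGF_RGF_of[OF P assms] length_RGF_of[OF P] contains_pattern_if_contains_1232[OF P]
      by auto
  next
    fix w assume "w \<in> ?R"
    then have w: "is_RGF w" "length w = n" "\<not> contains_1232 w" by simp_all
    from RGF_of_surj[OF w(1)] obtain \<sigma> where P: "partition_on {1..n} \<sigma>" "RGF_of n \<sigma> = w"
      unfolding w(2) by blast
    then have "\<not> contains_pattern \<sigma> pattern_1_24_3"
      using contains_1232_if_contains_pattern[OF P(1)] w(3) by auto
    with P show "w \<in> avoiding_RGFs n pattern_1_24_3"
      unfolding avoiding_RGFs_def avoiding_partitions_def by blast
  qed
  show "avoiding_RGFs n pattern_1_24_3 =
           {w. is_RGF w \<and> length w = n \<and>
               (let m = Max (set w) in
                  m \<le> 2 \<or>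
                  (m \<ge> 3 \<and> increasing_with_inserted_ones w) \<or>
                  (m \<ge> 3 \<and> ones_twos_then_increasing w))}"
    unfolding image
  proof (rule Collect_cong)
    fix w :: "nat list"
    show "(is_RGF w \<and> length w = n \<and> \<not> contains_1232 w) \<longleftrightarrow> (is_RGF w \<and> length w = n \<and>
               (let m = Max (set w) in
                  m \<le> 2 \<or>
                  (m \<ge> 3 \<and> increasing_with_inserted_ones w) \<or>
                  (m \<ge> 3 \<and> ones_twos_then_increasing w)))"
      using shaped_iff_form[of w] avoids_iff_shaped[of w] by blast
  qed
  obtain N where n: "n = Suc N" using assms by (cases n) simp_all
  \<comment> \<open>\<open>RGF_of\<close> is injective on set partitions, so words can be counted
    instead.\<close>
  have "card (avoiding_partitions n pattern_1_24_3) = card (avoiding_RGFs n pattern_1_24_3)"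
    unfolding avoiding_RGFs_def avoiding_partitions_def
    by (rule card_image[symmetric], rule inj_on_subset[OF inj_on_RGF_of]) blast
  also have "avoiding_RGFs n pattern_1_24_3 = (\<Union>s. words s n)"
    unfolding image words_def using avoids_iff_shaped by blast
  also have "card \<dots> = (\<Sum>s \<in> UNIV. card (words s n))"
    using words_disjoint by (intro card_UN_disjoint) (simp_all add: finite_shapes finite_words)
  also have "\<dots> = 1 + N + card (words Unsorted12 n) + card (words Increasing n)
      + (card (words Ones_Tail n) + card (words Resumed n))"
  proof -
    have U: "(UNIV :: shape set) = {Ones, Sorted12, Unsorted12, Increasing, Ones_Tail, Resumed}"
      using Collect_shape[of "\<lambda>_. True"] by auto
    show ?thesis unfolding U n using card_words(1,2)[of N] by simp
  qed
  \<comment> \<open>Together with \<open>Ones\<close> and \<open>Sorted12\<close>, these are the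
    words with at most two letters.\<close>
  also have "1 + N + card (words Unsorted12 n) = 2 ^ N"
    using card_words(3)[of N] by (simp add: n)
  also have "card (words Increasing n) = (\<Sum>m = 3..n. N choose (n - m))"
    using card_words(4)[of N] sum_binomial_truncated[of N] by (simp add: n)
  \<comment> \<open>The remaining words are matched with the double sum through the common closed
    form, not term by term.\<close>
  also have "card (words Ones_Tail n) + card (words Resumed n) =
      (\<Sum>m = 3..N. \<Sum>k = m - 1..N - 1.
        ((k - 1) choose (k + 1 - m)) * ((2 ^ (N - k) - 1) + (m - 2) * (N - k)))"
    using card_words(5)[of N] double_sum_closed_form[of N] unfolding n by linarith
  finally show "card (avoiding_partitions n pattern_1_24_3) =
           2 ^ (n - 1)
           + (\<Sum>m = 3..n. (n - 1) choose (n - m))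
           + (\<Sum>m = 3..n - 1. \<Sum>k = m - 1..n - 2.
                ((k - 1) choose (k + 1 - m))
                  * ((2 ^ (n - k - 1) - 1) + (m - 2) * (n - k - 1)))"
    by (simp add: n)
qed

end
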